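(* Let $M$ be a $G_X$-invariant surface of $(\mathbb{H}^2\times\mathbb{R},g)$, and let $\tilde\gamma(u)=(\xi_1(u),\xi_2(u))$ be its profile curve in the regular part of the orbit space $(\mathcal{B}=(\mathbb{H}^2\times\mathbb{R})/G_X,\tilde g)$, which is parametrized by the invariant functions $\xi_1$ and $\xi_2$. With respect to the local parametrization $\psi(u,v)=\phi_v(\gamma(u))$ we have: (i) If $G_X=G_{24}$ is the group generated by $X_2+bX_4$, $b\in\mathbb{R}$, then the orbit space is $\mathcal{B}=\{(\xi_1,\xi_2)\in\mathbb{R}^2:\xi_2>0\}$ and a loxodrome can be parametrized by $\psi(u,v(u))$, where $$v(u)=\int_{u_0}^u\frac{\left(b\sqrt{\xi_2(t)^2-\xi_2'(t)^2}\pm\cot\vartheta_0\right)\xi_2(t)}{\sqrt{1+b^2\xi_2(t)^2}}\,dt$$ and $\psi(u,v)=(v,\xi_2(u),bv-\xi_1(u))$. In particular, when $b=0$ (i.e. the group is $G_2$, generated by $X_2$) a loxodrome can be parametrized by $$\beta(u)=\left(\pm\cot\vartheta_0\int_{u_0}^u\xi_2(t)\,dt,\ \xi_2(u),\ -\xi_1(u)\right).$$ (ii) If $G_X=G_4$ (generated by $X_4$), the invariant surface is a right cylinder and its loxodromes are helices that can be parametrized by $$\beta(u)=(\xi_1(u),\xi_2(u),\cot\vartheta_0\,(u-u_0)).$$ (iii) If $G_X=G_{34}$ is the group generated by $X_3+bX_4$, $b\in\mathbb{R}$, then the orbit space is $\mathcal{B}=\{(\xi_1,\xi_2)\in\mathbb{R}^2:\xi_1\in(0,\pi)\}$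 and a loxodrome can be parametrized by $\psi(u,v(u))$, where $$v(u)=\int_{u_0}^u\frac{\left(-b\sqrt{\sin^2\xi_1(t)-\xi_1'(t)^2}\pm\cot\vartheta_0\right)\sin\xi_1(t)}{\sqrt{1+b^2\sin^2\xi_1(t)}}\,dt$$ and $\psi(u,v)=(e^v\cos\xi_1(u),e^v\sin\xi_1(u),\xi_2(u)+bv)$. (iv) If $G_X=G_{14}$ is the group generated by $X_1+bX_4$, $b\in\mathbb{R}$, then the orbit space is $\mathcal{B}=\{(\xi_1,\xi_2)\in\mathbb{R}^2:\xi_1\ge2\}$ and a loxodrome can be parametrized by $\psi(u,v(u))$, where $$v(u)=\int_{u_0}^u\frac{-4b\sqrt{\xi_1(t)^2-4-\xi_1'(t)^2}\pm2(\xi_1(t)^2-4)\cot\vartheta_0}{(\xi_1(t)^2-4)\sqrt{\xi_1(t)^2+4(b^2-1)}}\,dt$$ and $$\psi(u,v)=\left(\frac{\sqrt{\xi_1(u)^2-4}\,\sin v}{\sqrt{\xi_1(u)^2-4}\,\cos v-\xi_1(u)},\ \frac{2}{\xi_1(u)-\sqrt{\xi_1(u)^2-4}\,\cos v},\ \xi_2(u)+bv\right).$$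
   Context: $\mathbb{H}^2=\{(x,y)\in\mathbb{R}^2:y>0\}$ and $\mathbb{H}^2\times\mathbb{R}$ has the product metric $g=\frac{dx^2+dy^2}{y^2}+dz^2$. Killing fields: $X_1=\frac{x^2-y^2+1}{2}\partial_x+xy\,\partial_y$, $X_2=\partial_x$, $X_3=x\partial_x+y\partial_y$, $X_4=\partial_z$. For a Killing field $X$, $G_X$ is the one-parameter group of isometries it generates, with flow $\phi_v$. A $G_X$-invariant surface is an immersed surface in the regular part (union of principal orbits) invariant under $G_X$. Its profile curve is its projection to the orbit space $\mathcal{B}$, parametrized by arc length with respect to the quotient metric $\tilde g$ (the metric making the projection a Riemannian submersion on the regular part). The surface is locally $\psi(u,v)=\phi_v(\gamma(u))$, with $\gamma$ a lift of the profile curve. The coordinates on the orbit space and the quotient metrics are (with $x=r\cos\theta$, $y=r\sin\theta$): Case (i): $\xi_1=bx-z$, $\xi_2=y$, $\tilde g=\frac{d\xi_1^2}{1+b^2\xi_2^2}+\frac{d\xi_2^2}{\xi_2^2}$. Case (ii): $\xi_1=x$, $\xi_2=y$, $\tilde g=\frac{d\xi_1^2+d\xi_2^2}{\xi_2^2}$. Case (iii): $\xi_1=\theta$, $\xi_2=z-b\ln r$, $\tilde g=\frac{d\xi_1^2}{\sin^2\xi_1}+\frac{d\xi_2^2}{1+b^2\sin^2\xi_1}$. Case (iv): $\xi_1=\frac{r^2+1}{r\sin\theta}$, and (locally) $(\xi_1,\xi_2)$ represents the orbit through the point $x=0$, $y=\frac{\xi_1+\sqrt{\xi_1^2-4}}{2}$,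 $z=\xi_2$; $\tilde g=\frac{d\xi_1^2}{\xi_1^2-4}+\frac{\xi_1^2-4}{\xi_1^2+4(b^2-1)}d\xi_2^2$. A loxodrome on $M$ is a curve on $M$ making a constant angle $\vartheta_0$ with $X$: parametrized by arc length, $g(\alpha',X)=\|X\|\cos\vartheta_0$, $\vartheta_0\in[0,\pi)$. Throughout, loxodromes are assumed not to be orbits, i.e. $\vartheta_0\neq0$.
   Formalization: In (i), (iii), (iv) the printed square root is for ξ1'≥0 (resp. ξ2'≥0); in general it carries that derivative's sign, else the angle is wrong. In (iv), b≠0, the orbit space is a quotient of {ξ1≥2} (ξ2 mod 2πb where ξ1>2), not {ξ1≥2} itself. *)

theory Defs
  imports "HOL-Analysis.Analysis"
begin

type_synonym pt = "real \<times> real \<times> real"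

section \<open>The space \<open>H\<^sup>2 \<times> R\<close> and its Killing fields\<close>

definition H2R :: "pt set" where
  "H2R = {(x, y, z). y > 0}"

definition metric :: "pt \<Rightarrow> pt \<Rightarrow> pt \<Rightarrow> real" where
  "metric = (\<lambda>(x, y, z) (a1, a2, a3) (c1, c2, c3). (a1 * c1 + a2 * c2) / y\<^sup>2 + a3 * c3)"

definition gnorm :: "pt \<Rightarrow> pt \<Rightarrow> real" where
  "gnorm p w = sqrt (metric p w w)"

definition X1 :: "pt \<Rightarrow> pt" where
  "X1 = (\<lambda>(x, y, z). ((x\<^sup>2 - y\<^sup>2 + 1) / 2, x * y, 0))"

definition X2 :: "pt \<Rightarrow> pt" where
  "X2 = (\<lambda>(x, y, z). (1, 0, 0))"

definition X3 :: "pt \<Rightarrow> pt" where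
  "X3 = (\<lambda>(x, y, z). (x, y, 0))"

definition X4 :: "pt \<Rightarrow> pt" where
  "X4 = (\<lambda>(x, y, z). (0, 0, 1))"

definition X14 :: "real \<Rightarrow> pt \<Rightarrow> pt" where
  "X14 b p = X1 p + b *\<^sub>R X4 p"

definition X24 :: "real \<Rightarrow> pt \<Rightarrow> pt" where
  "X24 b p = X2 p + b *\<^sub>R X4 p"

definition X34 :: "real \<Rightarrow> pt \<Rightarrow> pt" where
  "X34 b p = X3 p + b *\<^sub>R X4 p"


section \<open>Flow, orbits, regular part\<close>

definition integral_curve :: "(pt \<Rightarrow> pt) \<Rightarrow> pt \<Rightarrow> (real \<Rightarrow> pt) \<Rightarrow> bool" where
  "integral_curve X p c \<longleftrightarrow>
     c 0 = p \<and> (\<forall>t. c t \<in> H2R \<and> (c has_vector_derivative X (c t)) (at t))"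

text \<open>Only meaningful for complete fields; all fields considered here are complete.\<close>

definition flow :: "(pt \<Rightarrow> pt) \<Rightarrow> real \<Rightarrow> pt \<Rightarrow> pt" where
  "flow X v p = (THE c. integral_curve X p c) v"

definition orbit :: "(pt \<Rightarrow> pt) \<Rightarrow> pt \<Rightarrow> pt set" where
  "orbit X p = range (\<lambda>v. flow X v p)"

definition orbit_space :: "(pt \<Rightarrow> pt) \<Rightarrow> pt set set" where
  "orbit_space X = orbit X ` H2R"

text \<open>The group of all \<open>flow X v\<close> is abelian and acts effectively, so its principal
  isotropy group is trivial: a point lies on a principal orbit iff every group element
  fixing it is the identity. The group elements are the maps \<open>flow X v\<close>, not the
  parameters \<open>v\<close>; the two differ when the flow is periodic (\<open>X1\<close>).\<close>

definition regular_part :: "(pt \<Rightarrow> pt) \<Rightarrow> pt set" where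
  "regular_part X = {p \<in> H2R. \<forall>v. flow X v p = p \<longrightarrow> (\<forall>q\<in>H2R. flow X v q = q)}"


section \<open>Coordinates on the orbit spaces and quotient metrics\<close>

text \<open>\<open>f\<close> identifies the orbit space, with its quotient topology, with \<open>B\<close>.\<close>

definition orbit_space_is :: "(pt \<Rightarrow> pt) \<Rightarrow> (pt \<Rightarrow> real \<times> real) \<Rightarrow> (real \<times> real) set \<Rightarrow> bool" where
  "orbit_space_is X f B \<longleftrightarrow>
     quotient_map (top_of_set H2R) (top_of_set B) f \<and>
     (\<forall>p\<in>H2R. \<forall>q\<in>H2R. f p = f q \<longleftrightarrow> orbit X p = orbit X q)"

text \<open>The orbit space is the quotient space of \<open>B\<close> under \<open>rep\<close>, where \<open>rep \<xi>\<close> is the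
  orbit represented by \<open>\<xi>\<close>: every orbit is represented, and a set of orbits is open iff its
  preimage in \<open>B\<close> is open. (Two points of \<open>B\<close> may represent the same orbit.)\<close>

definition orbit_space_represented_by ::
  "(pt \<Rightarrow> pt) \<Rightarrow> (real \<times> real \<Rightarrow> pt set) \<Rightarrow> (real \<times> real) set \<Rightarrow> bool" where
  "orbit_space_represented_by X rep B \<longleftrightarrow>
     rep ` B = orbit_space X \<and>
     (\<forall>V\<subseteq>orbit_space X.
        openin (top_of_set H2R) {p \<in> H2R. orbit X p \<in> V} \<longleftrightarrow>
        openin (top_of_set B) {\<xi> \<in> B. rep \<xi> \<in> V})"

definition inv24 :: "real \<Rightarrow> pt \<Rightarrow> real \<times> real" where
  "inv24 b = (\<lambda>(x, y, z). (b * x - z, y))"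

definition inv4 :: "pt \<Rightarrow> real \<times> real" where
  "inv4 = (\<lambda>(x, y, z). (x, y))"

definition inv34 :: "real \<Rightarrow> pt \<Rightarrow> real \<times> real" where
  "inv34 b = (\<lambda>(x, y, z). (Arg (Complex x y), z - b * ln (cmod (Complex x y))))"

text \<open>Since \<open>r\<^sup>2 = x\<^sup>2 + y\<^sup>2\<close> and \<open>r sin \<theta> = y\<close>, this is \<open>(r\<^sup>2 + 1) / (r sin \<theta>)\<close>.\<close>

definition xi14 :: "pt \<Rightarrow> real" where
  "xi14 = (\<lambda>(x, y, z). (x\<^sup>2 + y\<^sup>2 + 1) / y)"

definition inv1 :: "pt \<Rightarrow> real \<times> real" where
  "inv1 = (\<lambda>(x, y, z). (xi14 (x, y, z), z))"

text \<open>The orbit with given coordinates. For \<open>X14 b\<close> with \<open>b \<noteq> 0\<close> the second coordinate is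
  not a globally defined function on the space (it is an angular coordinate), so there the
  orbit is given through a representative.\<close>

definition level :: "(pt \<Rightarrow> real \<times> real) \<Rightarrow> real \<times> real \<Rightarrow> pt set" where
  "level f \<xi> = {p \<in> H2R. f p = \<xi>}"

definition orbit14 :: "real \<Rightarrow> real \<times> real \<Rightarrow> pt set" where
  "orbit14 b = (\<lambda>(\<xi>1, \<xi>2). orbit (X14 b) (0, (\<xi>1 + sqrt (\<xi>1\<^sup>2 - 4)) / 2, \<xi>2))"

definition B24 :: "(real \<times> real) set" where
  "B24 = {(\<xi>1, \<xi>2). \<xi>2 > 0}"

definition B34 :: "(real \<times> real) set" where
  "B34 = {(\<xi>1, \<xi>2). 0 < \<xi>1 \<and> \<xi>1 < pi}"

definition B14 :: "(real \<times> real) set" where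
  "B14 = {(\<xi>1, \<xi>2). \<xi>1 \<ge> 2}"

definition B14_reg :: "(real \<times> real) set" where
  "B14_reg = {(\<xi>1, \<xi>2). \<xi>1 > 2}"

text \<open>The metrics making the projections Riemannian submersions, as quadratic forms in the tangent vector \<open>(a1, a2)\<close> at
  \<open>(\<xi>1, \<xi>2)\<close>.\<close>

definition quot24 :: "real \<Rightarrow> real \<times> real \<Rightarrow> real \<times> real \<Rightarrow> real" where
  "quot24 b = (\<lambda>(\<xi>1, \<xi>2) (a1, a2). a1\<^sup>2 / (1 + b\<^sup>2 * \<xi>2\<^sup>2) + a2\<^sup>2 / \<xi>2\<^sup>2)"

definition quot4 :: "real \<times> real \<Rightarrow> real \<times> real \<Rightarrow> real" where
  "quot4 = (\<lambda>(\<xi>1, \<xi>2) (a1, a2). (a1\<^sup>2 + a2\<^sup>2) / \<xi>2\<^sup>2)"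

definition quot34 :: "real \<Rightarrow> real \<times> real \<Rightarrow> real \<times> real \<Rightarrow> real" where
  "quot34 b = (\<lambda>(\<xi>1, \<xi>2) (a1, a2).
     a1\<^sup>2 / (sin \<xi>1)\<^sup>2 + a2\<^sup>2 / (1 + b\<^sup>2 * (sin \<xi>1)\<^sup>2))"

definition quot14 :: "real \<Rightarrow> real \<times> real \<Rightarrow> real \<times> real \<Rightarrow> real" where
  "quot14 b = (\<lambda>(\<xi>1, \<xi>2) (a1, a2).
     a1\<^sup>2 / (\<xi>1\<^sup>2 - 4) + (\<xi>1\<^sup>2 - 4) / (\<xi>1\<^sup>2 + 4 * (b\<^sup>2 - 1)) * a2\<^sup>2)"


section \<open>Invariant surfaces and their profile curves\<close>

definition open_interval :: "real set \<Rightarrow> bool" where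
  "open_interval I \<longleftrightarrow> open I \<and> is_interval I \<and> I \<noteq> {}"

text \<open>\<open>M\<close> is the \<open>G\<^sub>X\<close>-invariant surface in the regular part whose projection to the orbit
  space is the arc-length parametrized curve \<open>(\<xi>1, \<xi>2)\<close>, defined on the open interval \<open>I\<close>.
  \<open>rep \<xi>\<close> is the orbit with coordinates \<open>\<xi>\<close>, \<open>B\<close> the range of the coordinates on the
  regular part and \<open>q\<close> the quotient metric. The profile curve may have self-intersections;
  that \<open>M\<close> is an immersed surface amounts to the profile curve being regular, which is part
  of its parametrization by arc length.\<close>

definition invariant_surface ::
  "(pt \<Rightarrow> pt) \<Rightarrow> (real \<times> real \<Rightarrow> pt set) \<Rightarrow> (real \<times> real) set \<Rightarrow>
   (real \<times> real \<Rightarrow> real \<times> real \<Rightarrow> real) \<Rightarrow> pt set \<Rightarrow> real set \<Rightarrow>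
   (real \<Rightarrow> real) \<Rightarrow> (real \<Rightarrow> real) \<Rightarrow> bool" where
  "invariant_surface X rep B q M I \<xi>1 \<xi>2 \<longleftrightarrow>
     M \<subseteq> regular_part X \<and> (\<forall>v. flow X v ` M \<subseteq> M) \<and>
     open_interval I \<and> \<xi>1 C1_differentiable_on I \<and> \<xi>2 C1_differentiable_on I \<and>
     (\<forall>u\<in>I. (\<xi>1 u, \<xi>2 u) \<in> B \<and> q (\<xi>1 u, \<xi>2 u) (deriv \<xi>1 u, deriv \<xi>2 u) = 1) \<and>
     orbit X ` M = (\<lambda>u. rep (\<xi>1 u, \<xi>2 u)) ` I"

text \<open>\<open>\<psi>(u,v) = \<phi>\<^sub>v(\<gamma>(u))\<close> with \<open>\<gamma> = \<psi>(\<cdot>, 0)\<close> a lift of the profile curve.\<close>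

definition surface_parametrization ::
  "(pt \<Rightarrow> pt) \<Rightarrow> (real \<times> real \<Rightarrow> pt set) \<Rightarrow> pt set \<Rightarrow> real set \<Rightarrow>
   (real \<Rightarrow> real) \<Rightarrow> (real \<Rightarrow> real) \<Rightarrow> (real \<Rightarrow> real \<Rightarrow> pt) \<Rightarrow> bool" where
  "surface_parametrization X rep M I \<xi>1 \<xi>2 \<psi> \<longleftrightarrow>
     (\<forall>u\<in>I. \<psi> u 0 \<in> rep (\<xi>1 u, \<xi>2 u) \<and> (\<forall>v. \<psi> u v = flow X v (\<psi> u 0))) \<and>
     M = {\<psi> u v | u v. u \<in> I}"


section \<open>Loxodromes\<close>

text \<open>Curves on the immersed surface \<open>\<psi>\<close> are those that lift to its parameter domain
  \<open>I \<times> R\<close>; for a surface with self-intersections this is more than lying in the image.\<close>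

definition curve_on :: "(real \<Rightarrow> real \<Rightarrow> pt) \<Rightarrow> real set \<Rightarrow> real set \<Rightarrow> (real \<Rightarrow> pt) \<Rightarrow> bool" where
  "curve_on \<psi> I J \<alpha> \<longleftrightarrow>
     (\<exists>h k. h C1_differentiable_on J \<and> k C1_differentiable_on J \<and>
        (\<forall>s\<in>J. h s \<in> I \<and> \<alpha> s = \<psi> (h s) (k s)))"

definition loxodrome ::
  "(pt \<Rightarrow> pt) \<Rightarrow> (real \<Rightarrow> real \<Rightarrow> pt) \<Rightarrow> real set \<Rightarrow> real \<Rightarrow> real set \<Rightarrow> (real \<Rightarrow> pt) \<Rightarrow> bool" where
  "loxodrome X \<psi> I \<theta> J \<alpha> \<longleftrightarrow>
     open_interval J \<and> curve_on \<psi> I J \<alpha> \<and>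
     (\<forall>s\<in>J. let \<alpha>' = vector_derivative \<alpha> (at s) in
        gnorm (\<alpha> s) \<alpha>' = 1 \<and>
        metric (\<alpha> s) \<alpha>' (X (\<alpha> s)) = gnorm (\<alpha> s) (X (\<alpha> s)) * cos \<theta>)"

definition parameter_change :: "real set \<Rightarrow> (real \<Rightarrow> real) \<Rightarrow> bool" where
  "parameter_change J h \<longleftrightarrow>
     open_interval J \<and> h C1_differentiable_on J \<and> (\<forall>s\<in>J. deriv h s \<noteq> 0)"

text \<open>The loxodromes of angle \<open>\<theta>\<close> on \<open>\<psi>\<close> are, up to change of parameter, the curves
  \<open>\<beta> 1\<close> and \<open>\<beta> (-1)\<close> (the two signs of \<open>\<plusminus>\<close>) and their images under the group. The group
  element is the constant of integration in \<open>v(u) = v(u\<^sub>0) + \<integral>\<close>; the sign says whether the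
  loxodrome is traversed in the direction of increasing or of decreasing \<open>u\<close>.

  The square root in the formulas for \<open>v\<close> comes from solving the arc-length equation of the
  profile curve for \<open>\<xi>1'\<close> (\<open>X24\<close>) or \<open>\<xi>2'\<close> (\<open>X34\<close>, \<open>X14\<close>), and so has to carry the sign of
  that derivative; the nonnegative root belongs to profile curves oriented such that the
  derivative is nonnegative.\<close>

definition loxodromes_given_by ::
  "(pt \<Rightarrow> pt) \<Rightarrow> (real \<Rightarrow> real \<Rightarrow> pt) \<Rightarrow> real set \<Rightarrow> real \<Rightarrow> (real \<Rightarrow> real \<Rightarrow> pt) \<Rightarrow> bool" where
  "loxodromes_given_by X \<psi> I \<theta> \<beta> \<longleftrightarrow>
     (\<forall>\<epsilon>\<in>{1, -1}. \<exists>J h. parameter_change J h \<and> h ` J = I \<and>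
        loxodrome X \<psi> I \<theta> J (\<lambda>s. \<beta> \<epsilon> (h s))) \<and>
     (\<forall>J \<alpha>. loxodrome X \<psi> I \<theta> J \<alpha> \<longrightarrow>
        (\<exists>\<epsilon>\<in>{1, -1}. \<exists>c h. parameter_change J h \<and> h ` J \<subseteq> I \<and>
           (\<forall>s\<in>J. \<alpha> s = flow X c (\<beta> \<epsilon> (h s)))))"

text \<open>A helix on a vertical cylinder: the height has constant slope with respect to the arc
  length of the projection to the hyperbolic plane.\<close>

definition helix :: "real set \<Rightarrow> (real \<Rightarrow> pt) \<Rightarrow> bool" where
  "helix J \<alpha> \<longleftrightarrow>
     (\<exists>m. \<forall>s\<in>J. \<exists>a1 a2 a3. (\<alpha> has_vector_derivative (a1, a2, a3)) (at s) \<and>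
        gnorm (\<alpha> s) (a1, a2, 0) > 0 \<and> a3 = m * gnorm (\<alpha> s) (a1, a2, 0))"

end

theory Submission
  imports Defs
begin

section \<open>Complete flows and their orbits\<close>

text \<open>Let \<open>\<psi> u v\<close> be the point reached after time v from a lift of the
  profile curve. The flow acts by isometries, so the first fundamental form E du^2 + 2 F du dv + G
  dv^2 of \<psi> depends on u only. The quotient metric measures the part of the u-derivative
  orthogonal to X, so unit speed of the profile curve means E - F^2/G = 1. Completing the square, a
  curve \<psi>(h(s), k(s)) has squared speed h'^2 + (F h' + G k')^2/G, where F h' + G k' is the
  inner product with X. For a unit speed curve of angle \<theta> this gives F h' + G k' = sqrt G cos
  \<theta> and h'^2 = sin^2 \<theta>. By continuity h' is one of the constants \<epsilon> sin
  \<theta> with \<epsilon> = 1 or -1, and dv/du = \<epsilon> cot \<theta> / sqrt G - F/G.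
  Conversely, any primitive of this slope gives a loxodrome after the substitution u = \<epsilon>
  sin \<theta> s, and the constant of integration is a group element. This is
  \<open>loxodromes_given_by\<close> in the locale \<open>invariant_immersion\<close>, with
  \<open>loxodromes_given_by_integral\<close> for primitives written as integrals.

  For each group it remains to compute E, F, G (\<open>invariant_immersion_X24\<close> and its
  analogues) and to rewrite the slope. F is, up to sign, b times the derivative of one orbit
  coordinate, and the unit speed equation determines the square of that derivative; this is where
  the square roots come from (\<open>sqrt_X24\<close>, \<open>integrand_X24\<close> and analogues).
  For X4 one has F = 0 and G = 1.

  All this needs the flows in closed form, and hence uniqueness of integral curves
  (\<open>complete_flow\<close>). For X24, X4, X34 and X1 the invariant functions have a section
  picking one point from each orbit, so their level sets are the orbits
  (\<open>invariants_eq_iff\<close>); if both are continuous, the invariants are a retraction and so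
  a quotient map (\<open>orbit_space_isI\<close>). X1 rotates the hyperbolic plane about (0,1), and
  in the hyperboloid model this rotation is linear (\<open>complete_flow_X14\<close>). For X14 an
  orbit off the axis meets the section at heights differing by multiples of 2 pi b
  (\<open>orbit14_cong_iff\<close>), so the coordinates only represent orbits. They still carry the
  right topology, because angles may be taken in a compact interval
  (\<open>orbit_space_represented_by_X14\<close>).\<close>

lemma has_vector_derivative_triple_iff:
  "((\<lambda>t. (f t, g t, k t)) has_vector_derivative (f', g', k')) (at t within S) \<longleftrightarrow>
   (f has_real_derivative f') (at t within S) \<and> (g has_real_derivative g') (at t within S) \<and>
   (k has_real_derivative k') (at t within S)"
proof
  assume L: "((\<lambda>t. (f t, g t, k t)) has_vector_derivative (f', g', k')) (at t within S)"
  have *: "((\<lambda>t. fst (f t, g t, k t)) has_vector_derivative fst (f', g', k')) (at t within S)"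
    "((\<lambda>t. snd (f t, g t, k t)) has_vector_derivative snd (f', g', k')) (at t within S)"
    by (rule bounded_linear.has_vector_derivative[OF bounded_linear_fst L]
             bounded_linear.has_vector_derivative[OF bounded_linear_snd L])+
  have "((\<lambda>t. fst (g t, k t)) has_vector_derivative fst (g', k')) (at t within S)"
    "((\<lambda>t. snd (g t, k t)) has_vector_derivative snd (g', k')) (at t within S)"
    by (rule bounded_linear.has_vector_derivative[OF bounded_linear_fst *(2)[unfolded snd_conv]]
             bounded_linear.has_vector_derivative[OF bounded_linear_snd *(2)[unfolded snd_conv]])+
  with *(1)
  show "(f has_real_derivative f') (at t within S) \<and> (g has_real_derivative g') (at t within S) \<and>
   (k has_real_derivative k') (at t within S)"
    by (simp add: has_real_derivative_iff_has_vector_derivative)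
qed (simp add: has_real_derivative_iff_has_vector_derivative has_vector_derivative_Pair)

lemma integral_curve_triple_iff:
  "integral_curve X (x, y, z) c \<longleftrightarrow>
     (\<exists>f g k. c = (\<lambda>t. (f t, g t, k t)) \<and> f 0 = x \<and> g 0 = y \<and> k 0 = z \<and> (\<forall>t. g t > 0) \<and>
       (\<forall>t. ((\<lambda>t. (f t, g t, k t)) has_vector_derivative X (f t, g t, k t)) (at t)))"
proof
  assume L: "integral_curve X (x, y, z) c"
  define f g k where fgk: "f t = fst (c t)" "g t = fst (snd (c t))" "k t = snd (snd (c t))" for t
  have c: "c = (\<lambda>t. (f t, g t, k t))" by (simp add: fgk)
  from L have "f 0 = x \<and> g 0 = y \<and> k 0 = z \<and> (\<forall>t. g t > 0) \<and>
       (\<forall>t. ((\<lambda>t. (f t, g t, k t)) has_vector_derivative X (f t, g t, k t)) (at t))"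
    unfolding c by (simp add: integral_curve_def H2R_def)
  with c show "\<exists>f g k. c = (\<lambda>t. (f t, g t, k t)) \<and> f 0 = x \<and> g 0 = y \<and> k 0 = z \<and> (\<forall>t. g t > 0) \<and>
       (\<forall>t. ((\<lambda>t. (f t, g t, k t)) has_vector_derivative X (f t, g t, k t)) (at t))"
    by blast
qed (auto simp: integral_curve_def H2R_def)

lemma constant_if_zero_derivative:
  fixes f :: "real \<Rightarrow> real"
  assumes "\<And>t. (f has_real_derivative 0) (at t)"
  shows "f t = f 0"
  using DERIV_isconst_all[of f t 0] assms by blast

text \<open>\<open>flow\<close> selects the integral curve by a definite description, so it agrees
  with a closed form \<Phi> only once \<Phi> is known to be the one integral curve.\<close>

locale complete_flow =
  fixes X :: "pt \<Rightarrow> pt" and \<Phi> :: "real \<Rightarrow> pt \<Rightarrow> pt"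
  assumes curve: "p \<in> H2R \<Longrightarrow> integral_curve X p (\<lambda>t. \<Phi> t p)"
    and unique: "p \<in> H2R \<Longrightarrow> integral_curve X p c \<Longrightarrow> c t = \<Phi> t p"
begin

lemma flow_unique: "p \<in> H2R \<Longrightarrow> integral_curve X p c \<Longrightarrow> flow X v p = c v"
  unfolding flow_def by (subst the_equality[of _ c]) (auto simp: unique)

lemma flow_eq: "p \<in> H2R \<Longrightarrow> flow X v p = \<Phi> v p"
  using flow_unique[OF _ curve] .

lemma flow_in: "p \<in> H2R \<Longrightarrow> flow X v p \<in> H2R"
  using curve by (auto simp: flow_eq integral_curve_def)

lemma flow_0: "p \<in> H2R \<Longrightarrow> flow X 0 p = p"
  using curve by (auto simp: flow_eq integral_curve_def)

text \<open>The time-shifted integral curve solves the same equation and starts at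
  \<open>flow X t p\<close>, so uniqueness gives the group law.\<close>

lemma flow_add:
  assumes p: "p \<in> H2R"
  shows "flow X s (flow X t p) = flow X (t + s) p"
proof -
  have "((\<lambda>s. \<Phi> (t + s) p) has_vector_derivative X (\<Phi> (t + s) p)) (at s)" for s
    using vector_diff_chain_at[of "\<lambda>s. t + s" 1 s "\<lambda>t. \<Phi> t p" "X (\<Phi> (t + s) p)"] curve[OF p]
      has_vector_derivative_add[OF has_vector_derivative_const has_vector_derivative_id, of t "at s"]
    by (simp add: integral_curve_def o_def)
  then have "integral_curve X (\<Phi> t p) (\<lambda>s. \<Phi> (t + s) p)"
    using curve[OF p] by (auto simp: integral_curve_def)
  from flow_unique[OF _ this, of s] show ?thesis
    using flow_in[OF p, of t] p by (simp add: flow_eq)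
qed

lemma orbit_eq_iff:
  assumes p: "p \<in> H2R"
  shows "q \<in> H2R \<Longrightarrow> orbit X p = orbit X q \<longleftrightarrow> q \<in> orbit X p"
proof
  assume q: "q \<in> H2R" "orbit X p = orbit X q"
  then show "q \<in> orbit X p" using flow_0[of q] unfolding orbit_def by (metis rangeI)
next
  assume "q \<in> H2R" "q \<in> orbit X p"
  then obtain t where t: "q = flow X t p" by (auto simp: orbit_def)
  have "flow X v p = flow X (v - t) q" for v
    unfolding t by (simp add: flow_add p)
  moreover have "flow X v q = flow X (t + v) p" for v
    unfolding t by (simp add: flow_add p)
  ultimately show "orbit X p = orbit X q" unfolding orbit_def by (metis (no_types) image_subset_iff rangeI subset_antisym)
qed

lemma orbit_subset: "p \<in> H2R \<Longrightarrow> orbit X p \<subseteq> H2R"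
  by (auto simp: orbit_def flow_in)

text \<open>An invariant M is a union of orbits, namely those over the profile curve. Hence it is
  swept out by the flow from any lift that picks a point of each of these orbits.\<close>

lemma surface_parametrizationI:
  assumes inv: "invariant_surface X rep B q M I \<xi>1 \<xi>2"
    and \<psi>: "\<And>u. u \<in> I \<Longrightarrow> \<psi> u 0 \<in> H2R" "\<And>u v. u \<in> I \<Longrightarrow> \<psi> u v = flow X v (\<psi> u 0)"
    and rep: "\<And>u. u \<in> I \<Longrightarrow> rep (\<xi>1 u, \<xi>2 u) = orbit X (\<psi> u 0)"
  shows "surface_parametrization X rep M I \<xi>1 \<xi>2 \<psi>"
proof -
  have M: "M \<subseteq> H2R" "\<And>v m. m \<in> M \<Longrightarrow> flow X v m \<in> M"
    and "orbit X ` M = (\<lambda>u. rep (\<xi>1 u, \<xi>2 u)) ` I"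
    using inv unfolding invariant_surface_def regular_part_def by blast+
  with rep have o: "orbit X ` M = (\<lambda>u. orbit X (\<psi> u 0)) ` I" by simp
  have "M = {\<psi> u v | u v. u \<in> I}"
  proof (intro equalityI subsetI)
    fix m assume m: "m \<in> M"
    then obtain u where u: "u \<in> I" "orbit X m = orbit X (\<psi> u 0)" using o by blast
    then have "m \<in> orbit X (\<psi> u 0)" using orbit_eq_iff[of "\<psi> u 0" m] \<psi>(1) M(1) m by blast
    then obtain v where "m = flow X v (\<psi> u 0)" by (auto simp: orbit_def)
    then have "m = \<psi> u v" using \<psi>(2)[OF u(1), of v] by simp
    then show "m \<in> {\<psi> u v | u v. u \<in> I}" using u(1) by blast
  next
    fix m assume "m \<in> {\<psi> u v | u v. u \<in> I}"
    then obtain u v where u: "u \<in> I" "m = \<psi> u v" by auto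
    then obtain m' where m': "m' \<in> M" "orbit X m' = orbit X (\<psi> u 0)" using o by (metis imageE imageI)
    have "m \<in> orbit X (\<psi> u 0)" unfolding u(2) \<psi>(2)[OF u(1), of v] orbit_def by (rule rangeI)
    then have "m \<in> orbit X m'" by (simp add: m')
    then show "m \<in> M" using M(2)[OF m'(1)] by (auto simp: orbit_def)
  qed
  moreover have "\<psi> u 0 \<in> orbit X (\<psi> u 0)" if "u \<in> I" for u
    using that \<psi>(1) flow_0[of "\<psi> u 0"] unfolding orbit_def by (metis rangeI)
  ultimately show ?thesis
    unfolding surface_parametrization_def using rep by (auto intro: \<psi>(2))
qed

context
  fixes f :: "pt \<Rightarrow> real \<times> real" and g :: "real \<times> real \<Rightarrow> pt" and B
  assumes f: "f ` H2R \<subseteq> B" and g: "g ` B \<subseteq> H2R"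
    and fg: "\<And>\<xi>. \<xi> \<in> B \<Longrightarrow> f (g \<xi>) = \<xi>"
    and f_inv: "\<And>p v. p \<in> H2R \<Longrightarrow> f (flow X v p) = f p"
    and gf: "\<And>p. p \<in> H2R \<Longrightarrow> g (f p) \<in> orbit X p"
begin

text \<open>\<open>g (f p)\<close> lies on the orbit of p and depends on \<open>f p\<close> alone,
  so equal invariants force equal orbits; the converse is invariance of f.\<close>

lemma invariants_eq_iff:
  assumes "p \<in> H2R" "q \<in> H2R"
  shows "f p = f q \<longleftrightarrow> orbit X p = orbit X q"
proof
  have "orbit X r = orbit X (g (f r))" if "r \<in> H2R" for r
    using that f g gf[OF that] orbit_eq_iff[of r "g (f r)"] by blast
  then show "f p = f q \<Longrightarrow> orbit X p = orbit X q" using assms by metis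
  assume "orbit X p = orbit X q"
  then have "q \<in> orbit X p" using assms orbit_eq_iff by simp
  then show "f p = f q" using assms(1) f_inv unfolding orbit_def by (metis imageE)
qed

text \<open>With a continuous right inverse g, the map f is a retraction, and retractions are
  quotient maps.\<close>

lemma orbit_space_isI:
  assumes "continuous_on H2R f" "continuous_on B g"
  shows "orbit_space_is X f B"
proof -
  have "retraction_map (top_of_set H2R) (top_of_set B) f"
    unfolding retraction_map_def retraction_maps_def using assms f g fg by (intro exI[of _ g]) auto
  then show ?thesis
    unfolding orbit_space_is_def
    using invariants_eq_iff retraction_imp_quotient_map by blast
qed

lemma level_eq_orbit:
  assumes "\<xi> \<in> B"
  shows "level f \<xi> = orbit X (g \<xi>)"
proof -
  have g\<xi>: "g \<xi> \<in> H2R" using assms g by blast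
  have "f p = \<xi> \<longleftrightarrow> p \<in> orbit X (g \<xi>)" if "p \<in> H2R" for p
    using invariants_eq_iff[OF g\<xi> that] orbit_eq_iff[OF g\<xi> that] fg[OF assms] by metis
  then show ?thesis using orbit_subset[OF g\<xi>] by (auto simp: level_def)
qed

end

end

section \<open>Closed forms of the flows of X24, X4 and X34\<close>

lemma complete_flow_X24:
  "complete_flow (X24 b) (\<lambda>t (x, y, z). (x + t, y, z + b * t))"
proof
  fix p :: pt assume "p \<in> H2R"
  then show "integral_curve (X24 b) p (\<lambda>t. case p of (x, y, z) \<Rightarrow> (x + t, y, z + b * t))"
    by (cases p) (auto simp: integral_curve_def H2R_def X24_def X2_def X4_def
         has_vector_derivative_triple_iff intro!: derivative_eq_intros)
next
  fix p :: pt and c t assume "p \<in> H2R" and c: "integral_curve (X24 b) p c"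
  obtain x y z where p: "p = (x, y, z)" by (cases p)
  from c[unfolded p integral_curve_triple_iff] obtain f g k where c: "c = (\<lambda>t. (f t, g t, k t))" "f 0 = x" "g 0 = y" "k 0 = z"
    and d: "\<And>t. (f has_real_derivative 1) (at t)" "\<And>t. (g has_real_derivative 0) (at t)"
      "\<And>t. (k has_real_derivative b) (at t)"
    by (auto simp: X24_def X2_def X4_def has_vector_derivative_triple_iff)
  \<comment> \<open>Uniqueness: undoing the candidate flow along an arbitrary integral curve leaves
    quantities of zero derivative.\<close>
  have "f t - t = f 0 - 0" "g t = g 0" "k t - b * t = k 0 - b * 0"
    by (rule constant_if_zero_derivative; auto intro!: derivative_eq_intros d)+
  then show "c t = (case p of (x, y, z) \<Rightarrow> (x + t, y, z + b * t))" by (simp add: c p)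
qed

lemma complete_flow_X4: "complete_flow X4 (\<lambda>t (x, y, z). (x, y, z + t))"
proof
  fix p :: pt assume "p \<in> H2R"
  then show "integral_curve X4 p (\<lambda>t. case p of (x, y, z) \<Rightarrow> (x, y, z + t))"
    by (cases p) (auto simp: integral_curve_def H2R_def X4_def
         has_vector_derivative_triple_iff intro!: derivative_eq_intros)
next
  fix p :: pt and c t assume "p \<in> H2R" and c: "integral_curve X4 p c"
  obtain x y z where p: "p = (x, y, z)" by (cases p)
  from c[unfolded p integral_curve_triple_iff] obtain f g k where c: "c = (\<lambda>t. (f t, g t, k t))" "f 0 = x" "g 0 = y" "k 0 = z"
    and d: "\<And>t. (f has_real_derivative 0) (at t)" "\<And>t. (g has_real_derivative 0) (at t)"
      "\<And>t. (k has_real_derivative 1) (at t)"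
    by (auto simp: X4_def has_vector_derivative_triple_iff)
  have "f t = f 0" "g t = g 0" "k t - t = k 0 - 0"
    by (rule constant_if_zero_derivative; auto intro!: derivative_eq_intros d)+
  then show "c t = (case p of (x, y, z) \<Rightarrow> (x, y, z + t))" by (simp add: c p)
qed

lemma complete_flow_X34:
  "complete_flow (X34 b) (\<lambda>t (x, y, z). (exp t * x, exp t * y, z + b * t))"
proof
  fix p :: pt assume "p \<in> H2R"
  then show "integral_curve (X34 b) p (\<lambda>t. case p of (x, y, z) \<Rightarrow> (exp t * x, exp t * y, z + b * t))"
    by (cases p) (auto simp: integral_curve_def H2R_def X34_def X3_def X4_def
         has_vector_derivative_triple_iff intro!: derivative_eq_intros)
next
  fix p :: pt and c t assume "p \<in> H2R" and c: "integral_curve (X34 b) p c"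
  obtain x y z where p: "p = (x, y, z)" by (cases p)
  from c[unfolded p integral_curve_triple_iff] obtain f g k where c: "c = (\<lambda>t. (f t, g t, k t))" "f 0 = x" "g 0 = y" "k 0 = z"
    and d: "\<And>t. (f has_real_derivative f t) (at t)" "\<And>t. (g has_real_derivative g t) (at t)"
      "\<And>t. (k has_real_derivative b) (at t)"
    by (auto simp: X34_def X3_def X4_def has_vector_derivative_triple_iff)
  \<comment> \<open>The factor exp (-t) undoes the dilation, so these quantities are
    constant.\<close>
  have "exp (-t) * f t = exp (-0) * f 0" "exp (-t) * g t = exp (-0) * g 0" "k t - b * t = k 0 - b * 0"
    by (rule constant_if_zero_derivative; auto intro!: derivative_eq_intros d)+
  then show "c t = (case p of (x, y, z) \<Rightarrow> (exp t * x, exp t * y, z + b * t))"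
    by (simp add: c p exp_minus field_simps)
qed

lemma metric_bilinear:
  "metric p (a *\<^sub>R v + c *\<^sub>R w) (a *\<^sub>R v + c *\<^sub>R w) =
     a\<^sup>2 * metric p v v + 2 * a * c * metric p v w + c\<^sup>2 * metric p w w"
  "metric p (a *\<^sub>R v + c *\<^sub>R w) w = a * metric p v w + c * metric p w w"
  by (cases p; cases v; cases w; simp add: metric_def divide_inverse power2_eq_square[of a] power2_eq_square[of c] algebra_simps)+

section \<open>Loxodromes and the first fundamental form\<close>

text \<open>Two functions f and g occur because an integrand containing sgn or a square root need
  not look continuous, nor be so outside I; on I it agrees with a manifestly continuous g.\<close>

lemma interval_integral_deriv:
  fixes f g :: "real \<Rightarrow> real"
  assumes I: "open_interval I" and g: "continuous_on I g"
    and fg: "\<And>t. t \<in> I \<Longrightarrow> f t = g t" and u: "u0 \<in> I" "u \<in> I"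
  shows "((\<lambda>u. LBINT t=u0..u. f t) has_real_derivative g u) (at u)"
proof -
  have op: "open I" and conv: "is_interval I" using I by (auto simp: open_interval_def)
  obtain e1 where e1: "e1 > 0" "cball u0 e1 \<subseteq> I" using op u open_contains_cball by blast
  obtain e2 where e2: "e2 > 0" "cball u e2 \<subseteq> I" using op u open_contains_cball by blast
  \<comment> \<open>The point u may lie on either side of u0. The compact interval from a to c lies
    in I and has both points in its interior, as the fundamental theorem requires here.\<close>
  define a where "a = min (u0 - e1) (u - e2)"
  define c where "c = max (u0 + e1) (u + e2)"
  have "a \<in> I" "c \<in> I" using e1 e2 by (auto simp: a_def c_def min_def max_def dist_real_def subset_eq)
  then have sub: "{a..c} \<subseteq> I" using conv unfolding is_interval_1 by (meson atLeastAtMost_iff subsetI)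
  have ac: "a < u0" "u0 < c" "a < u" "u < c" using e1 e2 by (auto simp: a_def c_def)
  have "continuous_on {a..c} f"
    using continuous_on_subset[OF g sub] sub fg by (metis continuous_on_cong subsetD)
  then have "((\<lambda>u. LBINT t=u0..u. f t) has_vector_derivative f u) (at u within {a..c})"
    using ac by (intro interval_integral_FTC2) auto
  then have "((\<lambda>u. LBINT t=u0..u. f t) has_vector_derivative f u) (at u within {a<..<c})"
    by (rule has_vector_derivative_within_subset) auto
  then show ?thesis
    using ac fg[OF u(2)] by (simp add: has_vector_derivative_within_open[of u "{a<..<c}"] has_real_derivative_iff_has_vector_derivative)
qed

lemma C1_real_onE:
  fixes f :: "real \<Rightarrow> real"
  assumes "f C1_differentiable_on S"
  shows "\<And>x. x \<in> S \<Longrightarrow> (f has_real_derivative deriv f x) (at x)" "continuous_on S (deriv f)"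
proof -
  obtain D where D: "\<And>x. x \<in> S \<Longrightarrow> (f has_real_derivative D x) (at x)" "continuous_on S D"
    using assms unfolding C1_differentiable_on_def has_real_derivative_iff_has_vector_derivative by blast
  then have "deriv f x = D x" if "x \<in> S" for x using that by (blast intro: DERIV_imp_deriv)
  with D show "\<And>x. x \<in> S \<Longrightarrow> (f has_real_derivative deriv f x) (at x)" "continuous_on S (deriv f)"
    by (simp_all cong: continuous_on_cong)
qed

lemma C1_real_onI:
  fixes f :: "real \<Rightarrow> real"
  assumes "\<And>x. x \<in> S \<Longrightarrow> (f has_real_derivative D x) (at x)" "continuous_on S D"
  shows "f C1_differentiable_on S"
  using assms unfolding C1_differentiable_on_def has_real_derivative_iff_has_vector_derivative by blast

text \<open>The image is connected and contained in the two-point set of c and -c, so it cannot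
  contain both: it would then contain 0.\<close>

lemma constant_sign_on_interval:
  fixes f :: "real \<Rightarrow> real"
  assumes "open_interval J" "continuous_on J f" and c: "c > 0" "\<And>s. s \<in> J \<Longrightarrow> (f s)\<^sup>2 = c\<^sup>2"
  shows "\<exists>\<epsilon>\<in>{1,-1}. \<forall>s\<in>J. f s = \<epsilon> * c"
proof -
  have pm: "f s = c \<or> f s = - c" if "s \<in> J" for s using c(2)[OF that] by (simp add: power2_eq_iff)
  have "connected (f ` J)" using assms by (auto simp: open_interval_def is_interval_connected intro: connected_continuous_image)
  then have iv: "is_interval (f ` J)" by (simp add: is_interval_connected_1)
  have "\<not> (f s = c \<and> f t = - c)" if "s \<in> J" "t \<in> J" for s t
  proof
    assume a: "f s = c \<and> f t = - c"
    then have "0 \<in> f ` J" using iv that c(1) unfolding is_interval_1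
      by (metis imageI less_eq_real_def neg_le_0_iff_le)
    then show False using pm c(1) by fastforce
  qed
  then show ?thesis using pm by force
qed

text \<open>The first fundamental form of \<open>\<psi>\<close> is \<open>E du\<^sup>2 + 2 F du dv + G dv\<^sup>2\<close>, with coefficients depending
  on \<open>u\<close> only; that the profile curve has unit speed means \<open>E - F\<^sup>2 / G = 1\<close>. Along a unit speed
  curve \<open>\<psi> (h s) (k s)\<close> with \<open>g(\<alpha>', X) = F h' + G k' = sqrt G cos \<theta>\<close> this forces \<open>h' = \<plusminus> sin \<theta>\<close>
  and hence determines \<open>dv/du = k'/h'\<close>.\<close>

locale invariant_immersion =
  fixes X :: "pt \<Rightarrow> pt" and \<psi> A :: "real \<Rightarrow> real \<Rightarrow> pt" and I :: "real set"
    and E F G :: "real \<Rightarrow> real"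
  assumes interval: "open_interval I"
    and translate: "u \<in> I \<Longrightarrow> flow X c (\<psi> u v) = \<psi> u (v + c)"
    and velocity: "\<lbrakk>h s \<in> I; (h has_real_derivative h') (at s); (k has_real_derivative k') (at s)\<rbrakk>
      \<Longrightarrow> ((\<lambda>s. \<psi> (h s) (k s)) has_vector_derivative
            (h' *\<^sub>R A (h s) (k s) + k' *\<^sub>R X (\<psi> (h s) (k s)))) (at s)"
    and EFG: "u \<in> I \<Longrightarrow> metric (\<psi> u v) (A u v) (A u v) = E u"
      "u \<in> I \<Longrightarrow> metric (\<psi> u v) (A u v) (X (\<psi> u v)) = F u"
      "u \<in> I \<Longrightarrow> metric (\<psi> u v) (X (\<psi> u v)) (X (\<psi> u v)) = G u"
    and G_pos: "u \<in> I \<Longrightarrow> G u > 0"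
    and arc_length: "u \<in> I \<Longrightarrow> E u - (F u)\<^sup>2 / G u = 1"
    and cont: "continuous_on I F" "continuous_on I G"
begin

text \<open>The second formula splits the velocity into its parts orthogonal and tangent to X: E
  h'^2 + 2 F h' k' + G k'^2 = (E - F^2/G) h'^2 + (F h' + G k')^2/G, where the first coefficient is 1
  by \<open>arc_length\<close>.\<close>

lemma speed:
  assumes "h s \<in> I" "(h has_real_derivative h') (at s)" "(k has_real_derivative k') (at s)"
  defines "\<alpha>' \<equiv> vector_derivative (\<lambda>s. \<psi> (h s) (k s)) (at s)"
  shows "metric (\<psi> (h s) (k s)) \<alpha>' (X (\<psi> (h s) (k s))) = h' * F (h s) + k' * G (h s)"
    and "metric (\<psi> (h s) (k s)) \<alpha>' \<alpha>' = h'\<^sup>2 + (h' * F (h s) + k' * G (h s))\<^sup>2 / G (h s)"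
proof -
  have \<alpha>': "\<alpha>' = h' *\<^sub>R A (h s) (k s) + k' *\<^sub>R X (\<psi> (h s) (k s))"
    unfolding \<alpha>'_def using velocity assms by (intro vector_derivative_at)
  show "metric (\<psi> (h s) (k s)) \<alpha>' (X (\<psi> (h s) (k s))) = h' * F (h s) + k' * G (h s)"
    unfolding \<alpha>' metric_bilinear by (simp add: EFG assms)
  have "E (h s) = 1 + (F (h s))\<^sup>2 / G (h s)" using arc_length[OF assms(1)] by simp
  then show "metric (\<psi> (h s) (k s)) \<alpha>' \<alpha>' = h'\<^sup>2 + (h' * F (h s) + k' * G (h s))\<^sup>2 / G (h s)"
    unfolding \<alpha>' metric_bilinear using G_pos[OF assms(1)]
    by (simp add: EFG assms field_simps power2_eq_square)
qed

text \<open>V may be any primitive of the slope, since primitives differ by a constant and shifting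
  v by a constant is the action of a group element (\<open>translate\<close>).\<close>

lemma loxodromes_given_by:
  fixes \<theta> :: real
  assumes \<theta>: "0 < \<theta>" "\<theta> < pi"
    and V: "\<And>\<epsilon> u. \<epsilon> \<in> {1, -1} \<Longrightarrow> u \<in> I \<Longrightarrow>
      (V \<epsilon> has_real_derivative (\<epsilon> * cot \<theta> / sqrt (G u) - F u / G u)) (at u)"
  shows "loxodromes_given_by X \<psi> I \<theta> (\<lambda>\<epsilon> u. \<psi> u (V \<epsilon> u))"
  unfolding loxodromes_given_by_def
proof (intro conjI ballI allI impI)
  have sin: "sin \<theta> > 0" using \<theta> by (simp add: sin_gt_zero)
  define W where "W \<epsilon> u = \<epsilon> * cot \<theta> / sqrt (G u) - F u / G u" for \<epsilon> u
  have W: "continuous_on I (W \<epsilon>)" for \<epsilon>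
    unfolding W_def using G_pos by (intro continuous_intros cont) force+
  {
    fix \<epsilon> :: real assume \<epsilon>: "\<epsilon> \<in> {1, -1}"
    \<comment> \<open>Unit speed forces h' to be plus or minus sin \<theta>, so the arc-length
      parameter is linear in u; taking J as the full preimage makes h cover I.\<close>
    define h where "h s = \<epsilon> * sin \<theta> * s" for s
    define J where "J = h -` I"
    have h': "(h has_real_derivative \<epsilon> * sin \<theta>) (at s)" for s
      unfolding h_def by (auto intro!: derivative_eq_intros)
    have conth: "continuous_on S h" for S unfolding h_def by (intro continuous_intros)
    have nz: "\<epsilon> * sin \<theta> \<noteq> 0" using \<epsilon> sin by auto
    then have inv: "h (u / (\<epsilon> * sin \<theta>)) = u" for u by (simp add: h_def)
    have hJ: "h ` J = I"
    proof (intro equalityI subsetI)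
      fix u assume "u \<in> I"
      then have "u / (\<epsilon> * sin \<theta>) \<in> J" using inv by (simp add: J_def)
      then show "u \<in> h ` J" using inv by (metis imageI)
    qed (auto simp: J_def)
    have "is_interval J" unfolding is_interval_1
    proof (intro ballI allI impI)
      fix s t x assume st: "s \<in> J" "t \<in> J" "s \<le> x \<and> x \<le> t"
      show "x \<in> J"
      proof (cases "\<epsilon> * sin \<theta> \<ge> 0")
        case True
        then have "h s \<le> h x" "h x \<le> h t" using st unfolding h_def by (auto intro: mult_left_mono)
        then show ?thesis using st interval unfolding J_def open_interval_def is_interval_1 by blast
      next
        case False
        then have "h x \<le> h s" "h t \<le> h x" using st unfolding h_def by (auto intro: mult_left_mono_neg)
        then show ?thesis using st interval unfolding J_def open_interval_def is_interval_1 by blast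
      qed
    qed
    moreover have "open J" unfolding J_def using interval conth by (auto simp: open_interval_def intro: open_vimage)
    ultimately have J: "open_interval J" using hJ interval by (auto simp: open_interval_def)
    have hC1: "h C1_differentiable_on J" using h' by (intro C1_real_onI[of _ _ "\<lambda>_. \<epsilon> * sin \<theta>"]) auto
    have pc: "parameter_change J h"
      unfolding parameter_change_def using J hC1 nz DERIV_imp_deriv[OF h'] by auto
    have k': "((\<lambda>s. V \<epsilon> (h s)) has_real_derivative W \<epsilon> (h s) * (\<epsilon> * sin \<theta>)) (at s)" if "s \<in> J" for s
      using DERIV_chain2[OF _ h'] V[OF \<epsilon>] that unfolding J_def W_def by blast
    have "continuous_on J (\<lambda>s. W \<epsilon> (h s) * (\<epsilon> * sin \<theta>))"
      using hJ by (intro continuous_intros continuous_on_compose2[OF W conth]) auto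
    then have "(\<lambda>s. V \<epsilon> (h s)) C1_differentiable_on J" using k' by (rule C1_real_onI[rotated])
    then have "curve_on \<psi> I J (\<lambda>s. \<psi> (h s) (V \<epsilon> (h s)))"
      unfolding curve_on_def using hC1 hJ by blast
    moreover have "gnorm (\<psi> (h s) (V \<epsilon> (h s))) \<alpha>' = 1 \<and>
        metric (\<psi> (h s) (V \<epsilon> (h s))) \<alpha>' (X (\<psi> (h s) (V \<epsilon> (h s))))
          = gnorm (\<psi> (h s) (V \<epsilon> (h s))) (X (\<psi> (h s) (V \<epsilon> (h s)))) * cos \<theta>"
      if s: "s \<in> J" and "\<alpha>' = vector_derivative (\<lambda>s. \<psi> (h s) (V \<epsilon> (h s))) (at s)" for s \<alpha>'
    proof -
      have hs: "h s \<in> I" using s by (simp add: J_def)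
      have G: "G (h s) > 0" "sqrt (G (h s)) * sqrt (G (h s)) = G (h s)" using G_pos[OF hs] by auto
      have e: "\<epsilon> * \<epsilon> = 1" using \<epsilon> by auto
      \<comment> \<open>The term - F/G of the slope cancels the contribution of F h' to the inner
        product with X, leaving sqrt G cos \<theta> because \<epsilon>^2 = 1.\<close>
      have "\<epsilon> * sin \<theta> * F (h s) + W \<epsilon> (h s) * (\<epsilon> * sin \<theta>) * G (h s)
          = (\<epsilon> * \<epsilon>) * (sin \<theta> * cot \<theta>) * (G (h s) / sqrt (G (h s)))"
        using G(1) by (simp add: W_def algebra_simps)
      also have "\<dots> = sqrt (G (h s)) * cos \<theta>"
        using G sin e by (simp add: cot_def real_div_sqrt)
      finally have c: "\<epsilon> * sin \<theta> * F (h s) + W \<epsilon> (h s) * (\<epsilon> * sin \<theta>) * G (h s) = sqrt (G (h s)) * cos \<theta>" .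
      have "metric (\<psi> (h s) (V \<epsilon> (h s))) \<alpha>' \<alpha>' = (\<epsilon> * sin \<theta>)\<^sup>2 + (sqrt (G (h s)) * cos \<theta>)\<^sup>2 / G (h s)"
        unfolding that(2) speed(2)[OF hs h' k'[OF s]] c ..
      also have "\<dots> = (\<epsilon> * \<epsilon>) * (sin \<theta>)\<^sup>2 + (cos \<theta>)\<^sup>2"
        using G(1) by (simp add: power_mult_distrib power2_eq_square[of \<epsilon>])
      finally show ?thesis
        using speed(1)[OF hs h' k'[OF s]] e c EFG(3)[OF hs] unfolding that(2) gnorm_def by simp
    qed
    ultimately have "loxodrome X \<psi> I \<theta> J (\<lambda>s. \<psi> (h s) (V \<epsilon> (h s)))"
      unfolding loxodrome_def Let_def using J by blast
    then show "\<exists>J h. parameter_change J h \<and> h ` J = I \<and> loxodrome X \<psi> I \<theta> J (\<lambda>s. \<psi> (h s) (V \<epsilon> (h s)))"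
      using pc hJ by blast
  }
  fix J \<alpha> assume lox: "loxodrome X \<psi> I \<theta> J \<alpha>"
  then have J: "open_interval J" by (simp add: loxodrome_def)
  obtain h k where C1: "h C1_differentiable_on J" "k C1_differentiable_on J"
    and hI: "\<And>s. s \<in> J \<Longrightarrow> h s \<in> I" and \<alpha>: "\<And>s. s \<in> J \<Longrightarrow> \<alpha> s = \<psi> (h s) (k s)"
    using lox unfolding loxodrome_def curve_on_def by blast
  note d = C1_real_onE[OF C1(1)] C1_real_onE[OF C1(2)]
  have main: "deriv h s * F (h s) + deriv k s * G (h s) = sqrt (G (h s)) * cos \<theta>"
    "(deriv h s)\<^sup>2 = (sin \<theta>)\<^sup>2" if s: "s \<in> J" for s
  proof -
    \<comment> \<open>\<alpha> has the form \<psi>(h, k) only on J; since J is open, this still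
      fixes the derivative at s.\<close>
    have "vector_derivative \<alpha> (at s) = vector_derivative (\<lambda>s. \<psi> (h s) (k s)) (at s)"
    proof (rule vector_derivative_cong_eq)
      show "\<forall>\<^sub>F x in nhds s. x \<in> UNIV \<longrightarrow> \<alpha> x = \<psi> (h x) (k x)"
        using J s \<alpha> eventually_nhds[of _ s] unfolding open_interval_def by blast
    qed auto
    then have lx: "gnorm (\<psi> (h s) (k s)) (vector_derivative (\<lambda>s. \<psi> (h s) (k s)) (at s)) = 1"
      "metric (\<psi> (h s) (k s)) (vector_derivative (\<lambda>s. \<psi> (h s) (k s)) (at s)) (X (\<psi> (h s) (k s))) =
       gnorm (\<psi> (h s) (k s)) (X (\<psi> (h s) (k s))) * cos \<theta>"
      using lox s \<alpha>[OF s] unfolding loxodrome_def Let_def by auto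
    note sp = speed[OF hI[OF s] d(1)[OF s] d(3)[OF s]]
    show c: "deriv h s * F (h s) + deriv k s * G (h s) = sqrt (G (h s)) * cos \<theta>"
      using lx(2) unfolding sp gnorm_def EFG(3)[OF hI[OF s]] .
    have "(deriv h s)\<^sup>2 + (cos \<theta>)\<^sup>2 = 1"
      using lx(1) G_pos[OF hI[OF s]] unfolding sp gnorm_def c by (simp add: power_mult_distrib)
    then show "(deriv h s)\<^sup>2 = (sin \<theta>)\<^sup>2" by (simp add: sin_squared_eq)
  qed
  \<comment> \<open>h' is continuous and never zero, so a single sign holds on all of J.\<close>
  obtain \<epsilon> where \<epsilon>: "\<epsilon> \<in> {1, -1}" and h': "\<And>s. s \<in> J \<Longrightarrow> deriv h s = \<epsilon> * sin \<theta>"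
    using constant_sign_on_interval[OF J d(2) sin main(2)] by blast
  have k': "deriv k s = W \<epsilon> (h s) * deriv h s" if s: "s \<in> J" for s
  proof -
    have G: "G (h s) > 0" "sqrt (G (h s)) * sqrt (G (h s)) = G (h s)" using G_pos[OF hI[OF s]] by auto
    have e: "\<epsilon> * \<epsilon> = 1" using \<epsilon> by auto
    have "W \<epsilon> (h s) * deriv h s * G (h s) = (\<epsilon> * \<epsilon>) * (sin \<theta> * cot \<theta>) * (G (h s) / sqrt (G (h s))) - deriv h s * F (h s)"
      using G(1) h'[OF s] by (simp add: W_def algebra_simps)
    also have "\<dots> = sqrt (G (h s)) * cos \<theta> - deriv h s * F (h s)"
      using G sin e by (simp add: cot_def real_div_sqrt)
    also have "\<dots> = deriv k s * G (h s)" using main(1)[OF s] by simp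
    finally show ?thesis using G(1) by simp
  qed
  \<comment> \<open>k and V composed with h have the same derivative; their constant difference is
    the parameter of the group element.\<close>
  have "((\<lambda>s. k s - V \<epsilon> (h s)) has_real_derivative 0) (at s)" if "s \<in> J" for s
    using DERIV_diff[OF d(3)[OF that] DERIV_chain2[OF V[OF \<epsilon> hI[OF that]] d(1)[OF that]]] k'[OF that]
    by (simp add: W_def)
  then have "\<exists>c. \<forall>s\<in>J. k s - V \<epsilon> (h s) = c"
    using J has_field_derivative_zero_constant[of J "\<lambda>s. k s - V \<epsilon> (h s)"]
    unfolding open_interval_def by (auto simp: is_interval_convex has_field_derivative_at_within)
  then obtain c where c: "\<forall>s\<in>J. k s - V \<epsilon> (h s) = c" by blast
  have "k s = V \<epsilon> (h s) + c" if "s \<in> J" for s using bspec[OF c that] by simp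
  then have "\<alpha> s = flow X c (\<psi> (h s) (V \<epsilon> (h s)))" if "s \<in> J" for s
    using \<alpha> translate[OF hI] that by simp
  moreover have "parameter_change J h"
    unfolding parameter_change_def using J C1 h' \<epsilon> sin by auto
  ultimately show "\<exists>\<epsilon>\<in>{1, -1}. \<exists>c h. parameter_change J h \<and> h ` J \<subseteq> I \<and>
      (\<forall>s\<in>J. \<alpha> s = flow X c (\<psi> (h s) (V \<epsilon> (h s))))"
    using \<epsilon> hI by blast
qed

lemma loxodromes_given_by_integral:
  fixes \<theta> u0 :: real
  assumes \<theta>: "0 < \<theta>" "\<theta> < pi" and u0: "u0 \<in> I"
    and f: "\<And>\<epsilon> u. u \<in> I \<Longrightarrow> f \<epsilon> u = \<epsilon> * cot \<theta> / sqrt (G u) - F u / G u"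
  shows "loxodromes_given_by X \<psi> I \<theta> (\<lambda>\<epsilon> u. \<psi> u (LBINT t=u0..u. f \<epsilon> t))"
proof (rule loxodromes_given_by[OF \<theta>])
  fix \<epsilon> u :: real assume u: "u \<in> I"
  have "continuous_on I (\<lambda>u. \<epsilon> * cot \<theta> / sqrt (G u) - F u / G u)"
    using G_pos by (intro continuous_intros cont) force+
  from interval_integral_deriv[OF interval this f u0 u]
  show "((\<lambda>u. LBINT t=u0..u. f \<epsilon> t) has_real_derivative \<epsilon> * cot \<theta> / sqrt (G u) - F u / G u) (at u)" .
qed

end

section \<open>The flow of \<open>X14\<close>\<close>

lemma H2R_iff [simp]: "(x, y, z) \<in> H2R \<longleftrightarrow> y > 0"
  by (simp add: H2R_def)

text \<open>With \<open>a = \<xi>\<^sub>1 - 2 / y\<close> and \<open>d = - 2 x / y\<close> the hyperbolic plane becomes the hyperboloid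
  \<open>\<xi>\<^sub>1\<^sup>2 = 4 + a\<^sup>2 + d\<^sup>2\<close>, on which \<open>X1\<close> acts by rotation in the \<open>(a, d)\<close>-plane.\<close>

definition hyperboloid_pt :: "real \<Rightarrow> real \<Rightarrow> real \<Rightarrow> real \<Rightarrow> pt" where
  "hyperboloid_pt \<xi> a d z = (d / (a - \<xi>), 2 / (\<xi> - a), z)"

definition rotate14 :: "real \<Rightarrow> real \<Rightarrow> pt \<Rightarrow> pt" where
  "rotate14 b t = (\<lambda>(x, y, z). let \<xi> = xi14 (x, y, z); a = \<xi> - 2 / y; d = - 2 * x / y in
     hyperboloid_pt \<xi> (a * cos t - d * sin t) (a * sin t + d * cos t) (z + b * t))"

text \<open>Positivity of \<xi> selects the upper sheet of the hyperboloid; there the denominator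
  \<xi> - a of \<open>hyperboloid_pt\<close> is positive.\<close>

lemma hyperboloid_less:
  fixes \<xi> a d :: real
  assumes "\<xi>\<^sup>2 = 4 + a\<^sup>2 + d\<^sup>2" "\<xi> > 0"
  shows "a < \<xi>"
proof (rule power2_less_imp_less)
  show "a\<^sup>2 < \<xi>\<^sup>2" using assms(1) zero_le_power2[of d] by linarith
qed (use assms(2) in simp)

lemma hyperboloid_coordinates:
  assumes "y > 0"
  shows "(xi14 (x, y, z))\<^sup>2 = 4 + (xi14 (x, y, z) - 2 / y)\<^sup>2 + (- 2 * x / y)\<^sup>2"
    and "xi14 (x, y, z) \<ge> 2"
    and "hyperboloid_pt (xi14 (x, y, z)) (xi14 (x, y, z) - 2 / y) (- 2 * x / y) z = (x, y, z)"
proof -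
  show "(xi14 (x, y, z))\<^sup>2 = 4 + (xi14 (x, y, z) - 2 / y)\<^sup>2 + (- 2 * x / y)\<^sup>2"
    using assms by (simp add: xi14_def field_simps power2_eq_square)
  \<comment> \<open>Equality holds exactly at (0, 1), the fixed point of X1 in the hyperbolic
    plane.\<close>
  have "x\<^sup>2 + (y - 1)\<^sup>2 \<ge> 0" by simp
  then have "2 * y \<le> x\<^sup>2 + y\<^sup>2 + 1" by (simp add: power2_eq_square algebra_simps)
  then show "xi14 (x, y, z) \<ge> 2" using assms by (simp add: xi14_def field_simps)
  show "hyperboloid_pt (xi14 (x, y, z)) (xi14 (x, y, z) - 2 / y) (- 2 * x / y) z = (x, y, z)"
    using assms by (simp add: hyperboloid_pt_def)
qed

context
  fixes \<xi> a d :: real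
  assumes \<xi>: "\<xi>\<^sup>2 = 4 + a\<^sup>2 + d\<^sup>2" "\<xi> > 0"
begin

lemma hyperboloid_pt_in: "hyperboloid_pt \<xi> a d z \<in> H2R"
  using hyperboloid_less[OF \<xi>] by (simp add: hyperboloid_pt_def)

lemma xi14_hyperboloid_pt: "xi14 (hyperboloid_pt \<xi> a d z) = \<xi>"
proof -
  have D: "\<xi> - a > 0" "(a - \<xi>)\<^sup>2 = (\<xi> - a)\<^sup>2" using hyperboloid_less[OF \<xi>] by (auto simp: power2_commute)
  have "(d / (a - \<xi>))\<^sup>2 + (2 / (\<xi> - a))\<^sup>2 + 1 = (d\<^sup>2 + 4 + (\<xi> - a)\<^sup>2) / (\<xi> - a)\<^sup>2"
    using D by (simp add: power_divide add_divide_distrib)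
  also have "d\<^sup>2 + 4 + (\<xi> - a)\<^sup>2 = 2 * \<xi> * (\<xi> - a)"
    using \<xi>(1) by (simp add: power2_eq_square algebra_simps)
  also have "\<dots> / (\<xi> - a)\<^sup>2 = \<xi> * (2 / (\<xi> - a))"
    using D(1) by (simp add: power2_eq_square)
  finally show ?thesis using D(1) by (simp add: xi14_def hyperboloid_pt_def)
qed

text \<open>These are the components obtained by differentiating \<open>hyperboloid_pt\<close> along
  the rotation a' = - d, d' = a with \<xi> fixed and z' = b.\<close>

lemma X14_hyperboloid_pt:
  "X14 b (hyperboloid_pt \<xi> a d z) = ((a\<^sup>2 + d\<^sup>2 - a * \<xi>) / (\<xi> - a)\<^sup>2, - 2 * d / (\<xi> - a)\<^sup>2, b)"
proof -
  have D: "\<xi> - a > 0" "(a - \<xi>)\<^sup>2 = (\<xi> - a)\<^sup>2" "d / (a - \<xi>) = - d / (\<xi> - a)"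
    using hyperboloid_less[OF \<xi>] minus_divide_right[of d "\<xi> - a"] by (auto simp: power2_commute)
  have "((d / (a - \<xi>))\<^sup>2 - (2 / (\<xi> - a))\<^sup>2 + 1) / 2 = (d\<^sup>2 - 4 + (\<xi> - a)\<^sup>2) / (2 * (\<xi> - a)\<^sup>2)"
    using D by (simp add: power_divide add_divide_distrib diff_divide_distrib)
  also have "d\<^sup>2 - 4 + (\<xi> - a)\<^sup>2 = 2 * (a\<^sup>2 + d\<^sup>2 - a * \<xi>)"
    using \<xi>(1) by (simp add: power2_eq_square algebra_simps)
  also have "2 * (a\<^sup>2 + d\<^sup>2 - a * \<xi>) / (2 * (\<xi> - a)\<^sup>2) = (a\<^sup>2 + d\<^sup>2 - a * \<xi>) / (\<xi> - a)\<^sup>2"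
    by (rule mult_divide_mult_cancel_left) simp
  finally have x: "((d / (a - \<xi>))\<^sup>2 - (2 / (\<xi> - a))\<^sup>2 + 1) / 2 = (a\<^sup>2 + d\<^sup>2 - a * \<xi>) / (\<xi> - a)\<^sup>2" .
  have y: "d / (a - \<xi>) * (2 / (\<xi> - a)) = - 2 * d / (\<xi> - a)\<^sup>2"
    unfolding D(3) by (simp add: power2_eq_square)
  show ?thesis
    unfolding X14_def X1_def X4_def hyperboloid_pt_def prod.case x y by simp
qed

lemma rotate14_hyperboloid_pt:
  "rotate14 b t (hyperboloid_pt \<xi> a d z) =
     hyperboloid_pt \<xi> (a * cos t - d * sin t) (a * sin t + d * cos t) (z + b * t)"
proof -
  have D: "\<xi> - a > 0" using hyperboloid_less[OF \<xi>] by auto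
  then have "d / (a - \<xi>) = - d / (\<xi> - a)" using minus_divide_right[of d "\<xi> - a"] by simp
  then have "\<xi> - 2 / (2 / (\<xi> - a)) = a" "- 2 * (d / (a - \<xi>)) / (2 / (\<xi> - a)) = d"
    using D by (simp_all add: diff_divide_distrib)
  moreover have "xi14 (d / (a - \<xi>), 2 / (\<xi> - a), z) = \<xi>"
    using xi14_hyperboloid_pt by (simp add: hyperboloid_pt_def)
  ultimately show ?thesis
    unfolding rotate14_def hyperboloid_pt_def[of \<xi> a d z] prod.case Let_def by simp
qed

end

lemma rotation_norm:
  fixes a d :: real
  shows "(a * cos t - d * sin t)\<^sup>2 + (a * sin t + d * cos t)\<^sup>2 = a\<^sup>2 + d\<^sup>2"
  by (simp add: power2_sum power2_diff power_mult_distrib sin_squared_eq algebra_simps)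

text \<open>In the coordinates (\<xi>, a, d) the horizontal equation is linear: \<xi> is a first
  integral and (a, d) rotates at unit speed. Both existence and uniqueness are read off
  there.\<close>

lemma complete_flow_X14: "complete_flow (X14 b) (rotate14 b)"
proof
  fix p :: pt assume p: "p \<in> H2R"
  obtain x y z where xyz: "p = (x, y, z)" by (cases p)
  define \<xi> where "\<xi> = xi14 p"
  define a where "a = \<xi> - 2 / y"
  define d where "d = - 2 * x / y"
  define ar dr where "ar t = a * cos t - d * sin t" and "dr t = a * sin t + d * cos t" for t
  have \<xi>: "\<xi>\<^sup>2 = 4 + a\<^sup>2 + d\<^sup>2" "\<xi> > 0" and p': "p = hyperboloid_pt \<xi> a d z"
    using hyperboloid_coordinates[of y x z] p unfolding \<xi>_def a_def d_def xyz by auto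
  have \<xi>t: "\<xi>\<^sup>2 = 4 + (ar t)\<^sup>2 + (dr t)\<^sup>2" for t
    using \<xi> rotation_norm[of a t d] unfolding ar_def dr_def by simp
  have rot: "(\<lambda>t. rotate14 b t p) = (\<lambda>t. hyperboloid_pt \<xi> (ar t) (dr t) (z + b * t))"
    unfolding p' rotate14_hyperboloid_pt[OF \<xi>] ar_def dr_def ..
  have deriv: "(ar has_real_derivative - dr t) (at t)"
    "(dr has_real_derivative ar t) (at t)" for t
    unfolding ar_def dr_def by (auto intro!: derivative_eq_intros)
  have "((\<lambda>t. hyperboloid_pt \<xi> (ar t) (dr t) (z + b * t)) has_vector_derivative
      X14 b (hyperboloid_pt \<xi> (ar t) (dr t) (z + b * t))) (at t)" for t
  proof -
    have D: "\<xi> - ar t > 0" "ar t - \<xi> \<noteq> 0" "(ar t - \<xi>) * (ar t - \<xi>) = (\<xi> - ar t)\<^sup>2"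
      using hyperboloid_less[OF \<xi>t \<xi>(2)] by (auto simp: power2_eq_square algebra_simps)
    show ?thesis
      unfolding X14_hyperboloid_pt[OF \<xi>t \<xi>(2)]
      unfolding hyperboloid_pt_def has_vector_derivative_triple_iff
      using D by (auto intro!: derivative_eq_intros deriv simp: power2_eq_square algebra_simps)
  qed
  then show "integral_curve (X14 b) p (\<lambda>t. rotate14 b t p)"
    unfolding integral_curve_def rot using hyperboloid_pt_in[OF \<xi>t \<xi>(2)]
    by (simp add: p' ar_def dr_def)
next
  fix p :: pt and c t assume p: "p \<in> H2R" and c: "integral_curve (X14 b) p c"
  obtain x y z where xyz: "p = (x, y, z)" by (cases p)
  from c[unfolded xyz integral_curve_triple_iff] obtain f g k where c: "c = (\<lambda>t. (f t, g t, k t))"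
    and init: "f 0 = x" "g 0 = y" "k 0 = z" and g: "\<And>t. g t > 0"
    and d: "\<And>t. (f has_real_derivative ((f t)\<^sup>2 - (g t)\<^sup>2 + 1) / 2) (at t)"
      "\<And>t. (g has_real_derivative f t * g t) (at t)" "\<And>t. (k has_real_derivative b) (at t)"
    by (auto simp: X14_def X1_def X4_def has_vector_derivative_triple_iff)
  define \<xi> A D where "\<xi> t = ((f t)\<^sup>2 + (g t)\<^sup>2 + 1) / g t" and "A t = \<xi> t - 2 / g t"
    and "D t = - 2 * f t / g t" for t
  have gn: "g t \<noteq> 0" for t using g[of t] by simp
  have d\<xi>: "(\<xi> has_real_derivative 0) (at t)" for t
    unfolding \<xi>_def using gn[of t] by (auto intro!: derivative_eq_intros d simp: field_simps power2_eq_square)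
  have dA: "(A has_real_derivative - D t) (at t)" for t
    unfolding A_def D_def using gn[of t] by (auto intro!: derivative_eq_intros d d\<xi> simp: field_simps)
  have dD: "(D has_real_derivative A t) (at t)" for t
    unfolding A_def D_def \<xi>_def using gn[of t] by (auto intro!: derivative_eq_intros d simp: field_simps power2_eq_square)
  \<comment> \<open>Rotating (A, D) back by the angle t gives a constant vector, so every integral
    curve is the rotated initial point.\<close>
  have "\<xi> t = \<xi> 0" "k t - b * t = k 0 - b * 0"
    "A t * cos t + D t * sin t = A 0 * cos 0 + D 0 * sin 0"
    "D t * cos t - A t * sin t = D 0 * cos 0 - A 0 * sin 0"
    by (rule constant_if_zero_derivative; auto intro!: derivative_eq_intros d d\<xi> dA dD simp: algebra_simps)+
  then have 0: "\<xi> t = \<xi> 0" "k t = z + b * t" and 1: "A 0 = A t * cos t + D t * sin t"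
    "D 0 = D t * cos t - A t * sin t" by (simp_all add: init)
  have 2: "A 0 * cos t - D 0 * sin t = A t" "A 0 * sin t + D 0 * cos t = D t"
    unfolding 1 using sin_cos_squared_add[of t] by algebra+
  have x: "xi14 (f s, g s, k s) = \<xi> s" for s by (simp add: xi14_def \<xi>_def)
  have "rotate14 b t p = hyperboloid_pt (\<xi> 0) (A t) (D t) (k t)"
    unfolding xyz rotate14_def prod.case Let_def 0(2) 2[symmetric] A_def[of 0] D_def[of 0]
    using x[of 0] by (simp add: init)
  also have "\<dots> = c t"
    using hyperboloid_coordinates(3)[OF g, of "f t" t "k t"] unfolding x 0(1) c A_def D_def by simp
  finally show "c t = rotate14 b t p" by simp
qed

section \<open>Polar coordinates about the axis of X1, and a section of the orbits\<close>

definition section14 :: "real \<times> real \<Rightarrow> pt" where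
  "section14 = (\<lambda>(\<xi>1, \<xi>2). (0, (\<xi>1 + sqrt (\<xi>1\<^sup>2 - 4)) / 2, \<xi>2))"

text \<open>Geodesic polar coordinates about (0, 1): \<xi> is 2 cosh of the hyperbolic distance to
  that point, sqrt (\<xi>^2 - 4) is 2 sinh of it, and v is the angle. With z = \<xi>2 + b v this is
  the parametrization for X14.\<close>

definition polar14 :: "real \<Rightarrow> real \<Rightarrow> real \<Rightarrow> pt" where
  "polar14 \<xi> v z = hyperboloid_pt \<xi> (sqrt (\<xi>\<^sup>2 - 4) * cos v) (sqrt (\<xi>\<^sup>2 - 4) * sin v) z"

context
  fixes \<xi> :: real
  assumes \<xi>: "\<xi> \<ge> 2"
begin

lemma four_le_square: "\<xi>\<^sup>2 \<ge> 4"
  using power_mono[OF \<xi>, of 2] by simp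

lemma polar_hyperboloid: "\<xi>\<^sup>2 = 4 + (sqrt (\<xi>\<^sup>2 - 4) * cos v)\<^sup>2 + (sqrt (\<xi>\<^sup>2 - 4) * sin v)\<^sup>2" "\<xi> > 0"
proof -
  show "\<xi>\<^sup>2 = 4 + (sqrt (\<xi>\<^sup>2 - 4) * cos v)\<^sup>2 + (sqrt (\<xi>\<^sup>2 - 4) * sin v)\<^sup>2"
    using four_le_square by (simp add: power_mult_distrib sin_squared_eq algebra_simps)
qed (use \<xi> in simp)

lemma polar14_in: "polar14 \<xi> v z \<in> H2R"
  unfolding polar14_def by (rule hyperboloid_pt_in[OF polar_hyperboloid])

lemma xi14_polar14: "xi14 (polar14 \<xi> v z) = \<xi>"
  unfolding polar14_def by (rule xi14_hyperboloid_pt[OF polar_hyperboloid])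

lemma flow_polar14: "flow (X14 b) t (polar14 \<xi> v z) = polar14 \<xi> (v + t) (z + b * t)"
  unfolding complete_flow.flow_eq[OF complete_flow_X14 polar14_in]
  unfolding polar14_def rotate14_hyperboloid_pt[OF polar_hyperboloid]
  by (simp add: cos_add sin_add algebra_simps)

text \<open>On x = 0 the invariant is y + 1/y, and the section takes the larger root y of y + 1/y =
  \<xi>. The smaller root is \<xi> minus that one, and the product of the roots is 1, which turns
  one formula into the other.\<close>

lemma section14_eq: "section14 (\<xi>, z) = polar14 \<xi> 0 z"
proof -
  have "\<xi> - sqrt (\<xi>\<^sup>2 - 4) > 0" using hyperboloid_less[OF polar_hyperboloid(1)[of 0] polar_hyperboloid(2)] by simp
  moreover have "(\<xi> + sqrt (\<xi>\<^sup>2 - 4)) * (\<xi> - sqrt (\<xi>\<^sup>2 - 4)) = 4"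
    using four_le_square by (simp add: algebra_simps flip: power2_eq_square)
  ultimately show ?thesis
    by (simp add: section14_def polar14_def hyperboloid_pt_def field_simps)
qed

end

lemma orbit14_eq: "orbit14 b \<xi> = orbit (X14 b) (section14 \<xi>)"
  by (cases \<xi>) (simp add: orbit14_def section14_def)

text \<open>The closed interval of angles is chosen for its compactness, which the topology of the
  orbit space relies on. On the axis the radius vanishes and the angle 0 serves.\<close>

lemma ex_polar14:
  assumes "y > 0"
  shows "\<exists>v\<in>{0..2 * pi}. xi14 (x, y, z) - 2 / y = sqrt ((xi14 (x, y, z))\<^sup>2 - 4) * cos v \<and>
    - 2 * x / y = sqrt ((xi14 (x, y, z))\<^sup>2 - 4) * sin v"
proof -
  define \<xi> where "\<xi> = xi14 (x, y, z)"
  define s where "s = sqrt (\<xi>\<^sup>2 - 4)"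
  note h = hyperboloid_coordinates(1,2)[OF assms, of x z, folded \<xi>_def]
  have s2: "s\<^sup>2 = (\<xi> - 2 / y)\<^sup>2 + (- 2 * x / y)\<^sup>2" unfolding s_def using h(1) by simp
  have "\<exists>v\<in>{0..2 * pi}. \<xi> - 2 / y = s * cos v \<and> - 2 * x / y = s * sin v"
  proof (cases "s = 0")
    case True
    then have "\<xi> - 2 / y = 0 \<and> - 2 * x / y = 0" using s2 by (simp add: sum_power2_eq_zero_iff)
    then show ?thesis using True by (intro bexI[of _ 0]) auto
  next
    case False
    have "((\<xi> - 2 / y) / s)\<^sup>2 + ((- 2 * x / y) / s)\<^sup>2 = ((\<xi> - 2 / y)\<^sup>2 + (- 2 * x / y)\<^sup>2) / s\<^sup>2"
      by (simp only: power_divide add_divide_distrib)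
    also have "\<dots> = 1" using False by (simp only: s2[symmetric]) simp
    finally obtain v where v: "0 \<le> v" "v \<le> 2 * pi" and c: "(\<xi> - 2 / y) / s = cos v" "(- 2 * x / y) / s = sin v"
      using sincos_total_2pi_le by blast
    show ?thesis using False v by (intro bexI[of _ v]) (simp_all flip: c)
  qed
  then show ?thesis unfolding s_def \<xi>_def .
qed

lemma polar14_eq:
  assumes "y > 0" "xi14 (x, y, z) - 2 / y = sqrt ((xi14 (x, y, z))\<^sup>2 - 4) * cos v"
    "- 2 * x / y = sqrt ((xi14 (x, y, z))\<^sup>2 - 4) * sin v"
  shows "(x, y, z) = polar14 (xi14 (x, y, z)) v z"
  using hyperboloid_coordinates(3)[OF assms(1), of x z] unfolding polar14_def assms(2,3)[symmetric] by simp

text \<open>Turning back by the angle v reaches the section and lowers the height by b v.\<close>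

lemma orbit_polar14:
  assumes "\<xi> \<ge> 2"
  shows "orbit (X14 b) (polar14 \<xi> v z) = orbit14 b (\<xi>, z - b * v)"
proof -
  have "flow (X14 b) (- v) (polar14 \<xi> v z) = section14 (\<xi>, z - b * v)"
    using assms by (simp add: flow_polar14 section14_eq)
  then have "section14 (\<xi>, z - b * v) \<in> orbit (X14 b) (polar14 \<xi> v z)"
    unfolding orbit_def by (metis rangeI)
  then show ?thesis
    using complete_flow.orbit_eq_iff[OF complete_flow_X14 polar14_in[OF assms]]
      polar14_in[OF assms] by (simp add: orbit14_eq section14_eq[OF assms])
qed

lemma section14_in: "\<xi> \<in> B14 \<Longrightarrow> section14 \<xi> \<in> H2R"
  by (cases \<xi>) (auto simp: B14_def section14_eq polar14_in)

lemma continuous_on_section14: "continuous_on B14 section14"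
  unfolding section14_def case_prod_beta by (intro continuous_intros) auto

lemma xi14_orbit14:
  assumes "\<xi> \<in> B14" "p \<in> orbit14 b \<xi>"
  shows "xi14 p = fst \<xi>"
  using assms by (cases \<xi>) (auto simp: B14_def orbit14_eq orbit_def section14_eq flow_polar14 xi14_polar14)

text \<open>Off the axis the flow returns to the section only after full turns, each of which
  changes the height by 2 pi b. On the axis every time would qualify, hence the strict bound on the
  first coordinate of \<xi>.\<close>

lemma orbit14_cong_iff:
  assumes "\<xi> \<in> B14_reg" "\<eta> \<in> B14"
  shows "orbit14 b \<xi> = orbit14 b \<eta> \<longleftrightarrow>
    fst \<eta> = fst \<xi> \<and> (\<exists>k::int. snd \<eta> = snd \<xi> + 2 * pi * b * of_int k)"
proof -
  obtain \<xi>1 \<xi>2 \<eta>1 \<eta>2 where e: "\<xi> = (\<xi>1, \<xi>2)" "\<eta> = (\<eta>1, \<eta>2)" by (cases \<xi>; cases \<eta>)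
  have g: "\<xi>1 > 2" "\<xi>1 \<ge> 2" "\<eta>1 \<ge> 2" using assms by (auto simp: e B14_def B14_reg_def)
  have "4 < \<xi>1\<^sup>2" using power_strict_mono[OF g(1), of 2] by simp
  then have s: "sqrt (\<xi>1\<^sup>2 - 4) > 0" by simp
  have "orbit14 b \<xi> = orbit14 b \<eta> \<longleftrightarrow> section14 \<eta> \<in> orbit (X14 b) (section14 \<xi>)"
    using complete_flow.orbit_eq_iff[OF complete_flow_X14, of "section14 \<xi>" "section14 \<eta>" b] g
    by (simp add: orbit14_eq section14_eq e polar14_in)
  also have "\<dots> \<longleftrightarrow> (\<exists>t. polar14 \<eta>1 0 \<eta>2 = polar14 \<xi>1 t (\<xi>2 + b * t))"
    using g by (auto simp: e section14_eq orbit_def flow_polar14)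
  also have "\<dots> \<longleftrightarrow> \<eta>1 = \<xi>1 \<and> (\<exists>k::int. \<eta>2 = \<xi>2 + 2 * pi * b * of_int k)"
  proof
    assume "\<exists>t. polar14 \<eta>1 0 \<eta>2 = polar14 \<xi>1 t (\<xi>2 + b * t)"
    then obtain t where t: "polar14 \<eta>1 0 \<eta>2 = polar14 \<xi>1 t (\<xi>2 + b * t)" ..
    then have \<eta>: "\<eta>1 = \<xi>1" using xi14_polar14 g by metis
    \<comment> \<open>Both denominators are positive, so equality of the y-coordinates can be
      cleared to an equation for cos t.\<close>
    have "\<xi>1 - sqrt (\<xi>1\<^sup>2 - 4) > 0" "\<xi>1 - sqrt (\<xi>1\<^sup>2 - 4) * cos t > 0"
      using hyperboloid_less[OF polar_hyperboloid(1)[OF g(2), of 0] polar_hyperboloid(2)[OF g(2)]]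
        hyperboloid_less[OF polar_hyperboloid(1)[OF g(2), of t] polar_hyperboloid(2)[OF g(2)]] by auto
    then have "sqrt (\<xi>1\<^sup>2 - 4) * cos t = sqrt (\<xi>1\<^sup>2 - 4)" and z: "\<eta>2 = \<xi>2 + b * t"
      using t \<eta> by (auto simp: polar14_def hyperboloid_pt_def field_simps)
    then have "cos t = 1" using s by simp
    then obtain k :: int where "t = of_int k * 2 * pi" by (auto simp: cos_one_2pi_int)
    then show "\<eta>1 = \<xi>1 \<and> (\<exists>k::int. \<eta>2 = \<xi>2 + 2 * pi * b * of_int k)"
      using \<eta> z by (auto intro!: exI[of _ k])
  next
    assume "\<eta>1 = \<xi>1 \<and> (\<exists>k::int. \<eta>2 = \<xi>2 + 2 * pi * b * of_int k)"
    then obtain k :: int where k: "\<eta>1 = \<xi>1" "\<eta>2 = \<xi>2 + 2 * pi * b * of_int k" by blast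
    have "cos (of_int k * 2 * pi) = 1" "sin (of_int k * 2 * pi) = 0"
      using cos_int_2pin[of k] sin_int_2pin[of k] by (simp_all add: ac_simps)
    then show "\<exists>t. polar14 \<eta>1 0 \<eta>2 = polar14 \<xi>1 t (\<xi>2 + b * t)"
      by (intro exI[of _ "of_int k * 2 * pi"]) (simp add: k polar14_def ac_simps)
  qed
  finally show ?thesis by (simp add: e)
qed

section \<open>The quotient topology for X14 and X1\<close>

lemma orbit_in_orbit14:
  assumes "p \<in> H2R"
  obtains v where "v \<in> {0..2 * pi}" "xi14 p - 2 / fst (snd p) = sqrt ((xi14 p)\<^sup>2 - 4) * cos v"
    "- 2 * fst p / fst (snd p) = sqrt ((xi14 p)\<^sup>2 - 4) * sin v"
    "(xi14 p, snd (snd p) - b * v) \<in> B14" "orbit (X14 b) p = orbit14 b (xi14 p, snd (snd p) - b * v)"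
proof -
  obtain x y z where p: "p = (x, y, z)" by (cases p)
  have y: "y > 0" using assms p by simp
  obtain v where v: "v \<in> {0..2 * pi}" "xi14 p - 2 / y = sqrt ((xi14 p)\<^sup>2 - 4) * cos v"
    "- 2 * x / y = sqrt ((xi14 p)\<^sup>2 - 4) * sin v" using ex_polar14[OF y, of x z] p by blast
  have \<xi>: "xi14 p \<ge> 2" using hyperboloid_coordinates(2)[OF y] p by simp
  have "p = polar14 (xi14 p) v z" using polar14_eq[OF y] v p by blast
  then have "orbit (X14 b) p = orbit14 b (xi14 p, z - b * v)" using orbit_polar14[OF \<xi>] by metis
  then show ?thesis using that[of v] v \<xi> by (simp add: p B14_def)
qed

lemma continuous_on_xi14: "continuous_on H2R xi14"
  unfolding xi14_def case_prod_beta by (intro continuous_intros) (auto simp: H2R_def)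

text \<open>An orbit has a representative on the section after a rotation by an angle in the compact
  interval \<open>[0, 2\<pi>]\<close>, so closedness of a set of coordinates is inherited by the union of the
  corresponding orbits.\<close>

lemma orbit_space_represented_by_X14: "orbit_space_represented_by (X14 b) (orbit14 b) B14"
  unfolding orbit_space_represented_by_def
proof (intro conjI allI impI)
  show rep: "orbit14 b ` B14 = orbit_space (X14 b)"
  proof (intro equalityI subsetI)
    fix O' assume "O' \<in> orbit14 b ` B14"
    then show "O' \<in> orbit_space (X14 b)"
      by (auto simp: orbit_space_def orbit14_eq section14_in)
  next
    fix O' assume "O' \<in> orbit_space (X14 b)"
    then obtain p where "p \<in> H2R" "O' = orbit (X14 b) p" by (auto simp: orbit_space_def)
    then show "O' \<in> orbit14 b ` B14" by (metis orbit_in_orbit14 imageI)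
  qed
  fix V assume V: "V \<subseteq> orbit_space (X14 b)"
  define P where "P = {p \<in> H2R. orbit (X14 b) p \<in> V}"
  define W where "W = {\<xi> \<in> B14. orbit14 b \<xi> \<in> V}"
  \<comment> \<open>The easy direction: W is the preimage of P under the continuous section.\<close>
  have "openin (top_of_set B14) W" if "openin (top_of_set H2R) P"
  proof -
    have "openin (top_of_set B14) (B14 \<inter> section14 -` P)"
      using continuous_openin_preimage[OF continuous_on_section14 _ that] section14_in by blast
    moreover have "B14 \<inter> section14 -` P = W"
      by (auto simp: P_def W_def orbit14_eq section14_in)
    ultimately show ?thesis by simp
  qed
  moreover have "openin (top_of_set H2R) P" if W: "openin (top_of_set B14) W"
  proof -
    \<comment> \<open>U collects the pairs (v, p) for which v is a polar angle of p
      (\<open>e\<close> vanishes) and the coordinates \<open>q\<close> obtained by turning p back by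
      v lie outside W. It is closed, and its projection along the compact angle interval is the
      complement of P.\<close>
    define S where "S = {0..2 * pi} \<times> H2R"
    define e where "e = (\<lambda>(v, p). (xi14 p - 2 / fst (snd p) - sqrt ((xi14 p)\<^sup>2 - 4) * cos v,
      - 2 * fst p / fst (snd p) - sqrt ((xi14 p)\<^sup>2 - 4) * sin v))"
    define q where "q = (\<lambda>(v, p). (xi14 p, snd (snd p) - b * v))"
    define U where "U = {vp \<in> S. e vp = (0, 0)} \<inter> (S \<inter> q -` (B14 - W))"
    have cx: "continuous_on S (\<lambda>vp. xi14 (snd vp))"
      by (rule continuous_on_compose2[OF continuous_on_xi14]) (auto simp: S_def intro!: continuous_intros)
    have pos: "fst (snd (snd vp)) \<noteq> 0" if "vp \<in> S" for vp
      using that by (auto simp: S_def H2R_def)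
    have "continuous_on S e"
      unfolding e_def case_prod_beta using pos by (intro continuous_intros cx) auto
    then have "closedin (top_of_set S) {vp \<in> S. e vp = (0, 0)}"
      by (rule continuous_closedin_preimage_constant)
    moreover have "closedin (top_of_set S) (S \<inter> q -` (B14 - W))"
    proof (rule continuous_closedin_preimage_gen)
      show "continuous_on S q" unfolding q_def case_prod_beta by (intro continuous_intros cx)
      have "xi14 p \<ge> 2" if "p \<in> H2R" for p
        using that hyperboloid_coordinates(2) by (cases p) simp
      then show "q \<in> S \<rightarrow> B14" by (auto simp: q_def S_def B14_def)
      show "closedin (top_of_set B14) (B14 - W)" using W by (simp add: closedin_def W_def double_diff)
    qed
    ultimately have "closedin (top_of_set ({0..2 * pi} \<times> H2R)) U" unfolding U_def S_def[symmetric] by blast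
    from closedin_compact_projection[OF compact_Icc this]
    have "closedin (top_of_set H2R) {p. \<exists>v. v \<in> {0..2 * pi} \<and> (v, p) \<in> U}" .
    moreover have "{p. \<exists>v. v \<in> {0..2 * pi} \<and> (v, p) \<in> U} = H2R - P"
    proof (intro equalityI subsetI)
      fix p assume "p \<in> {p. \<exists>v. v \<in> {0..2 * pi} \<and> (v, p) \<in> U}"
      then obtain v where v: "(v, p) \<in> U" by blast
      obtain x y z where p: "p = (x, y, z)" by (cases p)
      from v have h: "p \<in> H2R" "xi14 p - 2 / y = sqrt ((xi14 p)\<^sup>2 - 4) * cos v"
        "- 2 * x / y = sqrt ((xi14 p)\<^sup>2 - 4) * sin v" "(xi14 p, z - b * v) \<in> B14 - W"
        by (auto simp: U_def S_def e_def q_def p)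
      then have "p = polar14 (xi14 p) v z" using polar14_eq[of y x z v] p by auto
      moreover have "xi14 p \<ge> 2" using h(4) by (simp add: B14_def)
      ultimately have "orbit (X14 b) p = orbit14 b (xi14 p, z - b * v)" using orbit_polar14 by metis
      then show "p \<in> H2R - P" using h by (auto simp: P_def W_def)
    next
      fix p assume p: "p \<in> H2R - P"
      obtain v where v: "v \<in> {0..2 * pi}" "xi14 p - 2 / fst (snd p) = sqrt ((xi14 p)\<^sup>2 - 4) * cos v"
        "- 2 * fst p / fst (snd p) = sqrt ((xi14 p)\<^sup>2 - 4) * sin v"
        "(xi14 p, snd (snd p) - b * v) \<in> B14" "orbit (X14 b) p = orbit14 b (xi14 p, snd (snd p) - b * v)"
        using p orbit_in_orbit14 by blast
      then have "(v, p) \<in> U" using p by (auto simp: U_def S_def e_def q_def P_def W_def)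
      then show "p \<in> {p. \<exists>v. v \<in> {0..2 * pi} \<and> (v, p) \<in> U}" using v(1) by blast
    qed
    ultimately show ?thesis by (simp add: openin_closedin_eq P_def)
  qed
  ultimately show "openin (top_of_set H2R) {p \<in> H2R. orbit (X14 b) p \<in> V} \<longleftrightarrow>
      openin (top_of_set B14) {\<xi> \<in> B14. orbit14 b \<xi> \<in> V}"
    unfolding P_def W_def by blast
qed

text \<open>For b = 0 the flow preserves height, so z is a genuine global invariant and the
  retraction argument applies with the same section.\<close>

lemma orbit_space_is_X1: "orbit_space_is X1 inv1 B14"
proof -
  have X1: "X14 0 = X1" by (simp add: X14_def fun_eq_iff)
  interpret complete_flow "X14 0" "rotate14 0" by (rule complete_flow_X14)
  have \<xi>: "xi14 p \<ge> 2" if "p \<in> H2R" for p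
    using that hyperboloid_coordinates(2) by (cases p) simp
  have inv1: "inv1 p = (xi14 p, snd (snd p))" for p by (cases p) (simp add: inv1_def)
  have pol: "\<exists>v. p = polar14 (xi14 p) v (snd (snd p))" if "p \<in> H2R" for p
    using that ex_polar14 polar14_eq by (cases p) (metis H2R_iff snd_conv)
  have "orbit_space_is (X14 0) inv1 B14"
  proof (rule orbit_space_isI[where g = section14])
    show "inv1 ` H2R \<subseteq> B14" using \<xi> by (auto simp: inv1 B14_def)
    show "section14 ` B14 \<subseteq> H2R" using section14_in by blast
    show "inv1 (section14 \<xi>) = \<xi>" if "\<xi> \<in> B14" for \<xi>
    proof -
      have "xi14 (section14 \<xi>) = fst \<xi>" using that
        by (cases \<xi>) (simp add: B14_def section14_eq xi14_polar14)
      then show ?thesis by (cases \<xi>) (simp add: inv1 section14_def)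
    qed
    show "inv1 (flow (X14 0) v p) = inv1 p" if p: "p \<in> H2R" for p v
    proof -
      obtain w where w: "p = polar14 (xi14 p) w (snd (snd p))" using pol[OF p] by blast
      then have "flow (X14 0) v p = polar14 (xi14 p) (w + v) (snd (snd p))"
        using flow_polar14[OF \<xi>[OF p], of 0 v w] by (metis add.right_neutral mult_zero_left)
      then show ?thesis using xi14_polar14[OF \<xi>[OF p]] by (simp add: inv1 polar14_def hyperboloid_pt_def)
    qed
    show "section14 (inv1 p) \<in> orbit (X14 0) p" if p: "p \<in> H2R" for p
    proof -
      obtain w where w: "p = polar14 (xi14 p) w (snd (snd p))" using pol[OF p] by blast
      then have "flow (X14 0) (- w) p = section14 (inv1 p)"
        using flow_polar14[OF \<xi>[OF p], of 0 "- w" w] \<xi>[OF p]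
        by (metis add.right_neutral add.right_inverse inv1 mult_zero_left section14_eq)
      then show ?thesis unfolding orbit_def by (metis rangeI)
    qed
    show "continuous_on H2R inv1" unfolding inv1 by (intro continuous_intros continuous_on_xi14)
  qed (rule continuous_on_section14)
  then show ?thesis by (simp add: X1)
qed

section \<open>Invariant surfaces of the four groups\<close>

lemma orbit_space_X24:
  shows "orbit_space_is (X24 b) (inv24 b) B24"
    and "\<xi> \<in> B24 \<Longrightarrow> level (inv24 b) \<xi> = orbit (X24 b) (0, snd \<xi>, - fst \<xi>)"
proof -
  interpret complete_flow "X24 b" "\<lambda>t (x, y, z). (x + t, y, z + b * t)"
    by (rule complete_flow_X24)
  \<comment> \<open>The section is the slice x = 0, reached from (x, y, z) at time -x.\<close>
  have f: "inv24 b ` H2R \<subseteq> B24" and g: "(\<lambda>\<xi>. (0, snd \<xi>, - fst \<xi>)) ` B24 \<subseteq> H2R"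
    by (auto simp: inv24_def B24_def H2R_def)
  have fg: "inv24 b (0, snd \<xi>, - fst \<xi>) = \<xi>" for \<xi> :: "real \<times> real" by (simp add: inv24_def)
  have inv: "inv24 b (flow (X24 b) v p) = inv24 b p" if "p \<in> H2R" for v p
    using that by (cases p) (simp add: flow_eq inv24_def algebra_simps)
  have gf: "(0, snd (inv24 b p), - fst (inv24 b p)) \<in> orbit (X24 b) p" if "p \<in> H2R" for p
    using that unfolding orbit_def by (cases p) (auto simp: flow_eq inv24_def intro!: image_eqI[of _ _ "- fst p"])
  have "continuous_on H2R (inv24 b)" "continuous_on B24 (\<lambda>\<xi>. (0::real, snd \<xi>, - fst \<xi>))"
    unfolding inv24_def case_prod_beta by (intro continuous_intros)+
  then show "orbit_space_is (X24 b) (inv24 b) B24"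
    using f g fg inv gf by (intro orbit_space_isI)
  show "\<xi> \<in> B24 \<Longrightarrow> level (inv24 b) \<xi> = orbit (X24 b) (0, snd \<xi>, - fst \<xi>)"
    using f g fg inv gf by (intro level_eq_orbit)
qed

lemma level_X4:
  assumes "\<xi> \<in> B24"
  shows "level inv4 \<xi> = orbit X4 (fst \<xi>, snd \<xi>, 0)"
proof -
  interpret complete_flow X4 "\<lambda>t (x, y, z). (x, y, z + t)"
    by (rule complete_flow_X4)
  show ?thesis
  proof (rule level_eq_orbit[OF _ _ _ _ _ assms])
    show "inv4 ` H2R \<subseteq> B24" "(\<lambda>\<xi>. (fst \<xi>, snd \<xi>, 0)) ` B24 \<subseteq> H2R"
      by (auto simp: inv4_def B24_def H2R_def)
    show "inv4 (flow X4 v p) = inv4 p" if "p \<in> H2R" for v p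
      using that by (cases p) (simp add: flow_eq inv4_def)
    show "(fst (inv4 p), snd (inv4 p), 0) \<in> orbit X4 p" if "p \<in> H2R" for p
      using that unfolding orbit_def by (cases p) (auto simp: flow_eq inv4_def intro!: image_eqI[of _ _ "- snd (snd p)"])
  qed (simp add: inv4_def)
qed

lemma orbit_space_X34:
  shows "orbit_space_is (X34 b) (inv34 b) B34"
    and "\<xi> \<in> B34 \<Longrightarrow> level (inv34 b) \<xi> = orbit (X34 b) (cos (fst \<xi>), sin (fst \<xi>), snd \<xi>)"
proof -
  interpret complete_flow "X34 b" "\<lambda>t (x, y, z). (exp t * x, exp t * y, z + b * t)"
    by (rule complete_flow_X34)
  \<comment> \<open>The slice r = 1, reached at time - ln r; the height lost on the way is the term
    b ln r of the invariant.\<close>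
  let ?g = "\<lambda>\<xi>. (cos (fst \<xi>), sin (fst \<xi>), snd \<xi> :: real)"
  have f: "inv34 b ` H2R \<subseteq> B34"
    using Arg_lt_pi by (force simp: inv34_def B34_def H2R_def)
  have g: "?g ` B34 \<subseteq> H2R" by (auto simp: B34_def H2R_def sin_gt_zero)
  have fg: "inv34 b (?g \<xi>) = \<xi>" if "\<xi> \<in> B34" for \<xi>
    using that Arg_cis[of "fst \<xi>"] norm_cis[of "fst \<xi>"]
    by (cases \<xi>) (simp add: inv34_def B34_def cis.ctr del: norm_cis)
  have inv: "inv34 b (flow (X34 b) v p) = inv34 b p" if p: "p \<in> H2R" for v p
  proof -
    obtain x y z where xyz: "p = (x, y, z)" by (cases p)
    have nz: "Complex x y \<noteq> 0" using p xyz by (simp add: complex_eq_iff)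
    have "Complex (exp v * x) (exp v * y) = of_real (exp v) * Complex x y" by (simp add: complex_eq_iff)
    then have "Arg (Complex (exp v * x) (exp v * y)) = Arg (Complex x y)"
      "ln (cmod (Complex (exp v * x) (exp v * y))) = v + ln (cmod (Complex x y))"
      using nz by (simp_all add: Arg_times_of_real norm_mult ln_mult)
    then show ?thesis
      using p by (simp add: xyz flow_eq inv34_def algebra_simps)
  qed
  have gf: "?g (inv34 b p) \<in> orbit (X34 b) p" if p: "p \<in> H2R" for p
  proof -
    obtain x y z where xyz: "p = (x, y, z)" by (cases p)
    define r where "r = cmod (Complex x y)"
    have nz: "Complex x y \<noteq> 0" using p xyz by (simp add: complex_eq_iff)
    then have r: "r > 0" by (simp add: r_def)
    have "r * cos (Arg (Complex x y)) = x" "r * sin (Arg (Complex x y)) = y"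
      using rcis_cmod_Arg[of "Complex x y"] by (simp_all add: rcis_def complex_eq_iff r_def)
    then have "cos (Arg (Complex x y)) = inverse r * x" "sin (Arg (Complex x y)) = inverse r * y"
      using r by (auto simp: field_simps)
    then have "?g (inv34 b p) = flow (X34 b) (- ln r) p"
      using p r by (simp add: xyz flow_eq inv34_def exp_minus flip: r_def)
    then show ?thesis unfolding orbit_def by simp
  qed
  have "continuous_on H2R (\<lambda>p. Complex (fst p) (fst (snd p)))"
    by (auto simp: Complex_eq intro!: continuous_intros)
  \<comment> \<open>Arg is continuous off the closed negative real axis, which the open upper
    half-plane avoids.\<close>
  then have "continuous_on H2R (inv34 b)"
    unfolding inv34_def case_prod_beta
    by (intro continuous_intros) (auto simp: H2R_def complex_eq_iff complex_nonpos_Reals_iff)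
  moreover have "continuous_on B34 ?g" by (intro continuous_intros)
  ultimately show "orbit_space_is (X34 b) (inv34 b) B34"
    using f g fg inv gf by (intro orbit_space_isI)
  show "\<xi> \<in> B34 \<Longrightarrow> level (inv34 b) \<xi> = orbit (X34 b) (cos (fst \<xi>), sin (fst \<xi>), snd \<xi>)"
    using f g fg inv gf by (intro level_eq_orbit)
qed

text \<open>The root only recovers the absolute value of d times m. The sign is restored either by
  the factor sgn d or by assuming d nonnegative, whence the two versions of each formula.\<close>

lemma sgn_times_sqrt:
  fixes d m R :: real
  assumes "R = (d * m)\<^sup>2" "m > 0"
  shows "sgn d * sqrt R = d * m" "d \<ge> 0 \<Longrightarrow> sqrt R = d * m"
  using assms by (simp_all add: abs_mult sgn_mult_abs flip: mult.assoc)

lemma invariant_surfaceD: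
  assumes "invariant_surface X rep B q M I \<xi>1 \<xi>2"
  shows "open_interval I"
    and "u \<in> I \<Longrightarrow> (\<xi>1 has_real_derivative deriv \<xi>1 u) (at u)"
    and "u \<in> I \<Longrightarrow> (\<xi>2 has_real_derivative deriv \<xi>2 u) (at u)"
    and "continuous_on I \<xi>1" "continuous_on I \<xi>2"
    and "continuous_on I (deriv \<xi>1)" "continuous_on I (deriv \<xi>2)"
    and "u \<in> I \<Longrightarrow> (\<xi>1 u, \<xi>2 u) \<in> B"
    and "u \<in> I \<Longrightarrow> q (\<xi>1 u, \<xi>2 u) (deriv \<xi>1 u, deriv \<xi>2 u) = 1"
proof -
  have C1: "\<xi>1 C1_differentiable_on I" "\<xi>2 C1_differentiable_on I"
    using assms by (auto simp: invariant_surface_def)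
  show "open_interval I" "u \<in> I \<Longrightarrow> (\<xi>1 u, \<xi>2 u) \<in> B"
    "u \<in> I \<Longrightarrow> q (\<xi>1 u, \<xi>2 u) (deriv \<xi>1 u, deriv \<xi>2 u) = 1"
    using assms by (auto simp: invariant_surface_def)
  show "u \<in> I \<Longrightarrow> (\<xi>1 has_real_derivative deriv \<xi>1 u) (at u)"
    "u \<in> I \<Longrightarrow> (\<xi>2 has_real_derivative deriv \<xi>2 u) (at u)"
    "continuous_on I (deriv \<xi>1)" "continuous_on I (deriv \<xi>2)"
    using C1_real_onE[OF C1(1)] C1_real_onE[OF C1(2)] by blast+
  then show "continuous_on I \<xi>1" "continuous_on I \<xi>2"
    using C1_real_onE(1)[OF C1(1)] C1_real_onE(1)[OF C1(2)]
    by (meson DERIV_isCont continuous_at_imp_continuous_on)+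
qed

section \<open>Surfaces invariant under X24\<close>

context
  fixes b :: real and M :: "pt set" and I :: "real set" and \<xi>1 \<xi>2 :: "real \<Rightarrow> real"
  assumes surf: "invariant_surface (X24 b) (level (inv24 b)) B24 (quot24 b) M I \<xi>1 \<xi>2"
begin

lemma surface_parametrization_X24:
  "surface_parametrization (X24 b) (level (inv24 b)) M I \<xi>1 \<xi>2 (\<lambda>u v. (v, \<xi>2 u, b * v - \<xi>1 u))"
proof (rule complete_flow.surface_parametrizationI[OF complete_flow_X24 surf])
  fix u assume u: "u \<in> I"
  then have "(\<xi>1 u, \<xi>2 u) \<in> B24" using invariant_surfaceD[OF surf] by blast
  then show "(0, \<xi>2 u, b * 0 - \<xi>1 u) \<in> H2R"
    "level (inv24 b) (\<xi>1 u, \<xi>2 u) = orbit (X24 b) (0, \<xi>2 u, b * 0 - \<xi>1 u)"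
    "(v, \<xi>2 u, b * v - \<xi>1 u) = flow (X24 b) v (0, \<xi>2 u, b * 0 - \<xi>1 u)" for v
    by (auto simp: B24_def complete_flow.flow_eq[OF complete_flow_X24] orbit_space_X24(2))
qed

text \<open>The second family of vectors is the u-derivative of \<psi>. Subtracting F^2/G replaces
  \<xi>1'^2 by \<xi>1'^2 / (1 + b^2 \<xi>2^2), which is how \<open>quot24\<close> arises as the
  metric orthogonal to the orbits.\<close>

lemma invariant_immersion_X24:
  "invariant_immersion (X24 b) (\<lambda>u v. (v, \<xi>2 u, b * v - \<xi>1 u))
     (\<lambda>u v. (0, deriv \<xi>2 u, - deriv \<xi>1 u)) I (\<lambda>u. (deriv \<xi>2 u)\<^sup>2 / (\<xi>2 u)\<^sup>2 + (deriv \<xi>1 u)\<^sup>2)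
     (\<lambda>u. - b * deriv \<xi>1 u) (\<lambda>u. 1 / (\<xi>2 u)\<^sup>2 + b\<^sup>2)"
proof
  note D = invariant_surfaceD[OF surf]
  show "open_interval I" by (rule D)
  have pos: "\<xi>2 u > 0" if "u \<in> I" for u using D(8)[OF that] by (simp add: B24_def)
  show "flow (X24 b) c (v, \<xi>2 u, b * v - \<xi>1 u) = (v + c, \<xi>2 u, b * (v + c) - \<xi>1 u)" if "u \<in> I" for u v c
    using pos[OF that] by (simp add: complete_flow.flow_eq[OF complete_flow_X24] algebra_simps)
  show "((\<lambda>s. (k s, \<xi>2 (h s), b * k s - \<xi>1 (h s))) has_vector_derivative
      (h' *\<^sub>R (0, deriv \<xi>2 (h s), - deriv \<xi>1 (h s)) + k' *\<^sub>R X24 b (k s, \<xi>2 (h s), b * k s - \<xi>1 (h s)))) (at s)"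
    if s: "h s \<in> I" and h: "(h has_real_derivative h') (at s)" and k: "(k has_real_derivative k') (at s)"
    for h k s h' k'
    using k DERIV_chain2[OF D(3)[OF s] h] DERIV_diff[OF DERIV_cmult[OF k, of b] DERIV_chain2[OF D(2)[OF s] h]]
    by (simp add: X24_def X2_def X4_def has_vector_derivative_triple_iff algebra_simps)
  fix u assume u: "u \<in> I"
  note p = pos[OF u]
  show "metric (v, \<xi>2 u, b * v - \<xi>1 u) (0, deriv \<xi>2 u, - deriv \<xi>1 u) (0, deriv \<xi>2 u, - deriv \<xi>1 u)
      = (deriv \<xi>2 u)\<^sup>2 / (\<xi>2 u)\<^sup>2 + (deriv \<xi>1 u)\<^sup>2"
    "metric (v, \<xi>2 u, b * v - \<xi>1 u) (0, deriv \<xi>2 u, - deriv \<xi>1 u) (X24 b (v, \<xi>2 u, b * v - \<xi>1 u))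
      = - b * deriv \<xi>1 u"
    "metric (v, \<xi>2 u, b * v - \<xi>1 u) (X24 b (v, \<xi>2 u, b * v - \<xi>1 u)) (X24 b (v, \<xi>2 u, b * v - \<xi>1 u))
      = 1 / (\<xi>2 u)\<^sup>2 + b\<^sup>2" for v
    by (simp_all add: metric_def X24_def X2_def X4_def power2_eq_square)
  show G: "1 / (\<xi>2 u)\<^sup>2 + b\<^sup>2 > 0" using p by (simp add: add_pos_nonneg)
  have "1 + b\<^sup>2 * (\<xi>2 u)\<^sup>2 > 0" by (simp add: add_pos_nonneg)
  moreover have "1 / (\<xi>2 u)\<^sup>2 + b\<^sup>2 = (1 + b\<^sup>2 * (\<xi>2 u)\<^sup>2) / (\<xi>2 u)\<^sup>2" using p by (simp add: field_simps)
  ultimately have "(deriv \<xi>1 u)\<^sup>2 - (- b * deriv \<xi>1 u)\<^sup>2 / (1 / (\<xi>2 u)\<^sup>2 + b\<^sup>2) = (deriv \<xi>1 u)\<^sup>2 / (1 + b\<^sup>2 * (\<xi>2 u)\<^sup>2)"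
    by (simp add: field_simps power2_eq_square)
  then show "(deriv \<xi>2 u)\<^sup>2 / (\<xi>2 u)\<^sup>2 + (deriv \<xi>1 u)\<^sup>2 - (- b * deriv \<xi>1 u)\<^sup>2 / (1 / (\<xi>2 u)\<^sup>2 + b\<^sup>2) = 1"
    using D(9)[OF u] by (simp add: quot24_def)
next
  note D = invariant_surfaceD[OF surf]
  have "\<xi>2 u > 0" if "u \<in> I" for u using D(8)[OF that] by (simp add: B24_def)
  then show "continuous_on I (\<lambda>u. - b * deriv \<xi>1 u)" "continuous_on I (\<lambda>u. 1 / (\<xi>2 u)\<^sup>2 + b\<^sup>2)"
    using D by (force intro!: continuous_intros)+
qed

text \<open>With q = sqrt (1 + b^2 \<xi>2^2) one has sqrt G = q / \<xi>2, so the term - F/G becomes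
  b w \<xi>2 / q. Here w stands for the signed square root, and one computation covers both versions
  of the formula.\<close>

lemma integrand_X24:
  assumes u: "u \<in> I" and w: "w = deriv \<xi>1 u * (\<xi>2 u / sqrt (1 + b\<^sup>2 * (\<xi>2 u)\<^sup>2))"
  shows "(b * w + \<epsilon> * cot \<theta>) * \<xi>2 u / sqrt (1 + b\<^sup>2 * (\<xi>2 u)\<^sup>2) =
    \<epsilon> * cot \<theta> / sqrt (1 / (\<xi>2 u)\<^sup>2 + b\<^sup>2) - (- b * deriv \<xi>1 u) / (1 / (\<xi>2 u)\<^sup>2 + b\<^sup>2)"
proof -
  have p: "\<xi>2 u > 0" using invariant_surfaceD(8)[OF surf u] by (simp add: B24_def)
  define q where "q = sqrt (1 + b\<^sup>2 * (\<xi>2 u)\<^sup>2)"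
  have q: "q > 0" "q\<^sup>2 = 1 + b\<^sup>2 * (\<xi>2 u)\<^sup>2" by (simp_all add: q_def add_pos_nonneg)
  have G: "1 / (\<xi>2 u)\<^sup>2 + b\<^sup>2 = (q / \<xi>2 u)\<^sup>2" using p by (simp add: q(2) power_divide field_simps)
  from p q(1) have G': "sqrt (1 / (\<xi>2 u)\<^sup>2 + b\<^sup>2) = q / \<xi>2 u" unfolding G by simp
  show ?thesis
    unfolding G' unfolding G w q_def[symmetric] using p q(1)
    by (simp add: field_simps power2_eq_square)
qed

text \<open>The unit speed equation, multiplied by \<xi>2^2 and solved for \<xi>1', up to the sign
  supplied by \<open>sgn_times_sqrt\<close>.\<close>

lemma sqrt_X24:
  assumes u: "u \<in> I"
  shows "sgn (deriv \<xi>1 u) * sqrt ((\<xi>2 u)\<^sup>2 - (deriv \<xi>2 u)\<^sup>2) = deriv \<xi>1 u * (\<xi>2 u / sqrt (1 + b\<^sup>2 * (\<xi>2 u)\<^sup>2))"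
    and "deriv \<xi>1 u \<ge> 0 \<Longrightarrow> sqrt ((\<xi>2 u)\<^sup>2 - (deriv \<xi>2 u)\<^sup>2) = deriv \<xi>1 u * (\<xi>2 u / sqrt (1 + b\<^sup>2 * (\<xi>2 u)\<^sup>2))"
proof -
  have p: "\<xi>2 u > 0" using invariant_surfaceD(8)[OF surf u] by (simp add: B24_def)
  define q where "q = sqrt (1 + b\<^sup>2 * (\<xi>2 u)\<^sup>2)"
  have q: "q > 0" "q\<^sup>2 = 1 + b\<^sup>2 * (\<xi>2 u)\<^sup>2" by (simp_all add: q_def add_pos_nonneg)
  have "(deriv \<xi>1 u)\<^sup>2 / q\<^sup>2 + (deriv \<xi>2 u)\<^sup>2 / (\<xi>2 u)\<^sup>2 = 1"
    using invariant_surfaceD(9)[OF surf u] by (simp add: quot24_def q(2))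
  then have "(\<xi>2 u)\<^sup>2 - (deriv \<xi>2 u)\<^sup>2 = (deriv \<xi>1 u * (\<xi>2 u / q))\<^sup>2"
    using p q(1) by (simp add: field_simps)
  from sgn_times_sqrt[OF this] p q(1)
  show "sgn (deriv \<xi>1 u) * sqrt ((\<xi>2 u)\<^sup>2 - (deriv \<xi>2 u)\<^sup>2) = deriv \<xi>1 u * (\<xi>2 u / sqrt (1 + b\<^sup>2 * (\<xi>2 u)\<^sup>2))"
    and "deriv \<xi>1 u \<ge> 0 \<Longrightarrow> sqrt ((\<xi>2 u)\<^sup>2 - (deriv \<xi>2 u)\<^sup>2) = deriv \<xi>1 u * (\<xi>2 u / sqrt (1 + b\<^sup>2 * (\<xi>2 u)\<^sup>2))"
    unfolding q_def[symmetric] by simp_all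
qed

end

section \<open>Vertical cylinders: surfaces invariant under X4\<close>

context
  fixes M :: "pt set" and I :: "real set" and \<xi>1 \<xi>2 :: "real \<Rightarrow> real"
  assumes surf: "invariant_surface X4 (level inv4) B24 quot4 M I \<xi>1 \<xi>2"
begin

lemma surface_parametrization_X4:
  "surface_parametrization X4 (level inv4) M I \<xi>1 \<xi>2 (\<lambda>u v. (\<xi>1 u, \<xi>2 u, v))"
proof (rule complete_flow.surface_parametrizationI[OF complete_flow_X4 surf])
  fix u assume u: "u \<in> I"
  then have "(\<xi>1 u, \<xi>2 u) \<in> B24" using invariant_surfaceD[OF surf] by blast
  then show "(\<xi>1 u, \<xi>2 u, 0) \<in> H2R"
    "level inv4 (\<xi>1 u, \<xi>2 u) = orbit X4 (\<xi>1 u, \<xi>2 u, 0)"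
    "(\<xi>1 u, \<xi>2 u, v) = flow X4 v (\<xi>1 u, \<xi>2 u, 0)" for v
    by (auto simp: B24_def complete_flow.flow_eq[OF complete_flow_X4] level_X4)
qed

lemma invariant_immersion_X4:
  "invariant_immersion X4 (\<lambda>u v. (\<xi>1 u, \<xi>2 u, v))
     (\<lambda>u v. (deriv \<xi>1 u, deriv \<xi>2 u, 0)) I (\<lambda>_. 1) (\<lambda>_. 0) (\<lambda>_. 1)"
proof
  note D = invariant_surfaceD[OF surf]
  show "open_interval I" by (rule D)
  show "flow X4 c (\<xi>1 u, \<xi>2 u, v) = (\<xi>1 u, \<xi>2 u, v + c)" if "u \<in> I" for u v c
    using D(8)[OF that] by (simp add: complete_flow.flow_eq[OF complete_flow_X4] B24_def)
  show "((\<lambda>s. (\<xi>1 (h s), \<xi>2 (h s), k s)) has_vector_derivative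
      (h' *\<^sub>R (deriv \<xi>1 (h s), deriv \<xi>2 (h s), 0) + k' *\<^sub>R X4 (\<xi>1 (h s), \<xi>2 (h s), k s))) (at s)"
    if s: "h s \<in> I" and h: "(h has_real_derivative h') (at s)" and k: "(k has_real_derivative k') (at s)"
    for h k s h' k'
    using k DERIV_chain2[OF D(2)[OF s] h] DERIV_chain2[OF D(3)[OF s] h]
    by (simp add: X4_def has_vector_derivative_triple_iff mult.commute)
  show "metric (\<xi>1 u, \<xi>2 u, v) (deriv \<xi>1 u, deriv \<xi>2 u, 0) (deriv \<xi>1 u, deriv \<xi>2 u, 0) = 1" if "u \<in> I" for u v
    using D(9)[OF that, unfolded quot4_def prod.case] unfolding metric_def prod.case power2_eq_square
    by (simp only: mult_zero_left add_0_right)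
qed (simp_all add: metric_def X4_def)

text \<open>The profile curve has unit speed in the hyperbolic plane, so the horizontal speed of a
  loxodrome is sin \<theta> and its vertical speed is cos \<theta>; the slope is cot
  \<theta>.\<close>

lemma helix_X4:
  assumes \<theta>: "0 < \<theta>" "\<theta> < pi" and lox: "loxodrome X4 (\<lambda>u v. (\<xi>1 u, \<xi>2 u, v)) I \<theta> J \<alpha>"
  shows "helix J \<alpha>"
proof -
  interpret invariant_immersion X4 "\<lambda>u v. (\<xi>1 u, \<xi>2 u, v)"
    "\<lambda>u v. (deriv \<xi>1 u, deriv \<xi>2 u, 0)" I "\<lambda>_. 1" "\<lambda>_. 0" "\<lambda>_. 1" by (rule invariant_immersion_X4)
  have sin: "sin \<theta> > 0" using \<theta> by (simp add: sin_gt_zero)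
  have J: "open J" using lox by (simp add: loxodrome_def open_interval_def)
  obtain h k where C1: "h C1_differentiable_on J" "k C1_differentiable_on J"
    and hI: "\<And>s. s \<in> J \<Longrightarrow> h s \<in> I" and \<alpha>: "\<And>s. s \<in> J \<Longrightarrow> \<alpha> s = (\<xi>1 (h s), \<xi>2 (h s), k s)"
    using lox unfolding loxodrome_def curve_on_def by blast
  show ?thesis unfolding helix_def
  proof (rule exI[of _ "cot \<theta>"], rule ballI)
    fix s assume s: "s \<in> J"
    note d = C1_real_onE(1)[OF C1(1) s] C1_real_onE(1)[OF C1(2) s]
    have "((\<lambda>s. (\<xi>1 (h s), \<xi>2 (h s), k s)) has_vector_derivative
      (deriv h s * deriv \<xi>1 (h s), deriv h s * deriv \<xi>2 (h s), deriv k s)) (at s)"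
      using velocity[OF hI[OF s] d] by (simp add: X4_def)
    then have v: "(\<alpha> has_vector_derivative
      (deriv h s * deriv \<xi>1 (h s), deriv h s * deriv \<xi>2 (h s), deriv k s)) (at s)"
      by (rule has_vector_derivative_transform_within_open[OF _ J s]) (simp add: \<alpha>)
    have "metric (\<alpha> s) (deriv h s * deriv \<xi>1 (h s), deriv h s * deriv \<xi>2 (h s), 0)
        (deriv h s * deriv \<xi>1 (h s), deriv h s * deriv \<xi>2 (h s), 0)
      = (deriv h s)\<^sup>2 * metric (\<alpha> s) (deriv \<xi>1 (h s), deriv \<xi>2 (h s), 0) (deriv \<xi>1 (h s), deriv \<xi>2 (h s), 0)"
      unfolding \<alpha>[OF s] by (simp add: metric_def power2_eq_square algebra_simps)
    also have "\<dots> = (deriv h s)\<^sup>2"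
      unfolding \<alpha>[OF s] using EFG(1)[OF hI[OF s]] by simp
    finally have n: "metric (\<alpha> s) (deriv h s * deriv \<xi>1 (h s), deriv h s * deriv \<xi>2 (h s), 0)
        (deriv h s * deriv \<xi>1 (h s), deriv h s * deriv \<xi>2 (h s), 0) = (deriv h s)\<^sup>2" .
    note vd = vector_derivative_at[OF v]
    note vd' = vector_derivative_at[OF velocity[OF hI[OF s] d]]
    have vv: "vector_derivative \<alpha> (at s) = vector_derivative (\<lambda>s. (\<xi>1 (h s), \<xi>2 (h s), k s)) (at s)"
      unfolding vd vd' by (simp add: X4_def)
    have "gnorm (\<alpha> s) (vector_derivative \<alpha> (at s)) = 1"
      "metric (\<alpha> s) (vector_derivative \<alpha> (at s)) (X4 (\<alpha> s)) = gnorm (\<alpha> s) (X4 (\<alpha> s)) * cos \<theta>"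
      using lox s unfolding loxodrome_def Let_def by auto
    then have k: "deriv k s = cos \<theta>" and "(deriv h s)\<^sup>2 + (deriv k s)\<^sup>2 = 1"
      using speed[OF hI[OF s] d] EFG(3)[OF hI[OF s]] unfolding vv \<alpha>[OF s] gnorm_def by simp_all
    then have "(deriv h s)\<^sup>2 = (sin \<theta>)\<^sup>2" by (simp add: sin_squared_eq)
    then have "gnorm (\<alpha> s) (deriv h s * deriv \<xi>1 (h s), deriv h s * deriv \<xi>2 (h s), 0) = sin \<theta>"
      unfolding gnorm_def n using sin by simp
    then have "gnorm (\<alpha> s) (deriv h s * deriv \<xi>1 (h s), deriv h s * deriv \<xi>2 (h s), 0) > 0 \<and>
        deriv k s = cot \<theta> * gnorm (\<alpha> s) (deriv h s * deriv \<xi>1 (h s), deriv h s * deriv \<xi>2 (h s), 0)"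
      using sin k by (simp add: cot_def)
    with v show "\<exists>a1 a2 a3. (\<alpha> has_vector_derivative (a1, a2, a3)) (at s) \<and>
        gnorm (\<alpha> s) (a1, a2, 0) > 0 \<and> a3 = cot \<theta> * gnorm (\<alpha> s) (a1, a2, 0)"
      by blast
  qed
qed

text \<open>With F = 0 and G = 1 the slope is constant and its primitive is linear.\<close>

lemma loxodromes_X4:
  assumes "0 < \<theta>" "\<theta> < pi"
  shows "loxodromes_given_by X4 (\<lambda>u v. (\<xi>1 u, \<xi>2 u, v)) I \<theta>
    (\<lambda>\<epsilon> u. (\<xi>1 u, \<xi>2 u, \<epsilon> * cot \<theta> * (u - u0)))"
  by (rule invariant_immersion.loxodromes_given_by[OF invariant_immersion_X4 assms])
     (auto intro!: derivative_eq_intros)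

end

section \<open>Surfaces invariant under X34\<close>

context
  fixes b :: real and M :: "pt set" and I :: "real set" and \<xi>1 \<xi>2 :: "real \<Rightarrow> real"
  assumes surf: "invariant_surface (X34 b) (level (inv34 b)) B34 (quot34 b) M I \<xi>1 \<xi>2"
begin

lemma surface_parametrization_X34:
  "surface_parametrization (X34 b) (level (inv34 b)) M I \<xi>1 \<xi>2
     (\<lambda>u v. (exp v * cos (\<xi>1 u), exp v * sin (\<xi>1 u), \<xi>2 u + b * v))"
proof (rule complete_flow.surface_parametrizationI[OF complete_flow_X34 surf])
  fix u assume u: "u \<in> I"
  then have "(\<xi>1 u, \<xi>2 u) \<in> B34" using invariant_surfaceD[OF surf] by blast
  then show "(exp 0 * cos (\<xi>1 u), exp 0 * sin (\<xi>1 u), \<xi>2 u + b * 0) \<in> H2R"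
    "level (inv34 b) (\<xi>1 u, \<xi>2 u) = orbit (X34 b) (exp 0 * cos (\<xi>1 u), exp 0 * sin (\<xi>1 u), \<xi>2 u + b * 0)"
    "(exp v * cos (\<xi>1 u), exp v * sin (\<xi>1 u), \<xi>2 u + b * v) =
       flow (X34 b) v (exp 0 * cos (\<xi>1 u), exp 0 * sin (\<xi>1 u), \<xi>2 u + b * 0)" for v
    by (auto simp: B34_def sin_gt_zero complete_flow.flow_eq[OF complete_flow_X34] orbit_space_X34(2))
qed

text \<open>The horizontal components of the u-derivative and of X34 scale with exp v, as does the
  height y = exp v sin \<xi>1 in the metric. These factors cancel, so E, F and G do not depend on
  v.\<close>

lemma invariant_immersion_X34:
  "invariant_immersion (X34 b) (\<lambda>u v. (exp v * cos (\<xi>1 u), exp v * sin (\<xi>1 u), \<xi>2 u + b * v))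
     (\<lambda>u v. (- exp v * sin (\<xi>1 u) * deriv \<xi>1 u, exp v * cos (\<xi>1 u) * deriv \<xi>1 u, deriv \<xi>2 u)) I
     (\<lambda>u. (deriv \<xi>1 u)\<^sup>2 / (sin (\<xi>1 u))\<^sup>2 + (deriv \<xi>2 u)\<^sup>2)
     (\<lambda>u. b * deriv \<xi>2 u) (\<lambda>u. 1 / (sin (\<xi>1 u))\<^sup>2 + b\<^sup>2)"
proof
  note D = invariant_surfaceD[OF surf]
  show "open_interval I" by (rule D)
  have pos: "sin (\<xi>1 u) > 0" if "u \<in> I" for u using D(8)[OF that] by (simp add: B34_def sin_gt_zero)
  show "flow (X34 b) c (exp v * cos (\<xi>1 u), exp v * sin (\<xi>1 u), \<xi>2 u + b * v) =
      (exp (v + c) * cos (\<xi>1 u), exp (v + c) * sin (\<xi>1 u), \<xi>2 u + b * (v + c))" if "u \<in> I" for u v c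
    using pos[OF that] by (simp add: complete_flow.flow_eq[OF complete_flow_X34] exp_add algebra_simps)
  show "((\<lambda>s. (exp (k s) * cos (\<xi>1 (h s)), exp (k s) * sin (\<xi>1 (h s)), \<xi>2 (h s) + b * k s)) has_vector_derivative
      (h' *\<^sub>R (- exp (k s) * sin (\<xi>1 (h s)) * deriv \<xi>1 (h s), exp (k s) * cos (\<xi>1 (h s)) * deriv \<xi>1 (h s), deriv \<xi>2 (h s))
        + k' *\<^sub>R X34 b (exp (k s) * cos (\<xi>1 (h s)), exp (k s) * sin (\<xi>1 (h s)), \<xi>2 (h s) + b * k s))) (at s)"
    if s: "h s \<in> I" and h: "(h has_real_derivative h') (at s)" and k: "(k has_real_derivative k') (at s)"
    for h k s h' k'
    by (auto simp: X34_def X3_def X4_def has_vector_derivative_triple_iff algebra_simps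
        intro!: derivative_eq_intros k DERIV_chain2[OF D(2)[OF s] h] DERIV_chain2[OF D(3)[OF s] h])
  fix u assume u: "u \<in> I"
  note p = pos[OF u]
  have sc: "cos (\<xi>1 u) * cos (\<xi>1 u) = 1 - sin (\<xi>1 u) * sin (\<xi>1 u)"
    using cos_squared_eq[of "\<xi>1 u"] by (simp add: power2_eq_square)
  show "metric (exp v * cos (\<xi>1 u), exp v * sin (\<xi>1 u), \<xi>2 u + b * v)
       (- exp v * sin (\<xi>1 u) * deriv \<xi>1 u, exp v * cos (\<xi>1 u) * deriv \<xi>1 u, deriv \<xi>2 u)
       (- exp v * sin (\<xi>1 u) * deriv \<xi>1 u, exp v * cos (\<xi>1 u) * deriv \<xi>1 u, deriv \<xi>2 u)
      = (deriv \<xi>1 u)\<^sup>2 / (sin (\<xi>1 u))\<^sup>2 + (deriv \<xi>2 u)\<^sup>2" for v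
  proof -
    have "(- exp v * sin (\<xi>1 u) * deriv \<xi>1 u) * (- exp v * sin (\<xi>1 u) * deriv \<xi>1 u) +
        (exp v * cos (\<xi>1 u) * deriv \<xi>1 u) * (exp v * cos (\<xi>1 u) * deriv \<xi>1 u) = (exp v)\<^sup>2 * (deriv \<xi>1 u)\<^sup>2"
      using sc by algebra
    then show ?thesis unfolding metric_def prod.case
      by (simp only: power_mult_distrib) (simp add: power2_eq_square[of "deriv \<xi>2 u"])
  qed
  show "metric (exp v * cos (\<xi>1 u), exp v * sin (\<xi>1 u), \<xi>2 u + b * v)
       (- exp v * sin (\<xi>1 u) * deriv \<xi>1 u, exp v * cos (\<xi>1 u) * deriv \<xi>1 u, deriv \<xi>2 u)
       (X34 b (exp v * cos (\<xi>1 u), exp v * sin (\<xi>1 u), \<xi>2 u + b * v))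
      = b * deriv \<xi>2 u" for v
    by (simp add: metric_def X34_def X3_def X4_def)
  show "metric (exp v * cos (\<xi>1 u), exp v * sin (\<xi>1 u), \<xi>2 u + b * v)
       (X34 b (exp v * cos (\<xi>1 u), exp v * sin (\<xi>1 u), \<xi>2 u + b * v))
       (X34 b (exp v * cos (\<xi>1 u), exp v * sin (\<xi>1 u), \<xi>2 u + b * v))
      = 1 / (sin (\<xi>1 u))\<^sup>2 + b\<^sup>2" for v
  proof -
    have "(exp v * cos (\<xi>1 u)) * (exp v * cos (\<xi>1 u)) + (exp v * sin (\<xi>1 u)) * (exp v * sin (\<xi>1 u)) = (exp v)\<^sup>2"
      using sc by algebra
    then show ?thesis by (simp add: metric_def X34_def X3_def X4_def power_mult_distrib power2_eq_square[of b])
  qed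
  show G: "1 / (sin (\<xi>1 u))\<^sup>2 + b\<^sup>2 > 0" using p by (simp add: add_pos_nonneg)
  have "1 + b\<^sup>2 * (sin (\<xi>1 u))\<^sup>2 > 0" by (simp add: add_pos_nonneg)
  moreover have "1 / (sin (\<xi>1 u))\<^sup>2 + b\<^sup>2 = (1 + b\<^sup>2 * (sin (\<xi>1 u))\<^sup>2) / (sin (\<xi>1 u))\<^sup>2"
    using p by (simp add: field_simps)
  ultimately have "(deriv \<xi>2 u)\<^sup>2 - (b * deriv \<xi>2 u)\<^sup>2 / (1 / (sin (\<xi>1 u))\<^sup>2 + b\<^sup>2)
      = (deriv \<xi>2 u)\<^sup>2 / (1 + b\<^sup>2 * (sin (\<xi>1 u))\<^sup>2)"
    by (simp add: field_simps power2_eq_square)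
  then show "(deriv \<xi>1 u)\<^sup>2 / (sin (\<xi>1 u))\<^sup>2 + (deriv \<xi>2 u)\<^sup>2 - (b * deriv \<xi>2 u)\<^sup>2 / (1 / (sin (\<xi>1 u))\<^sup>2 + b\<^sup>2) = 1"
    using D(9)[OF u] by (simp add: quot34_def)
next
  note D = invariant_surfaceD[OF surf]
  have "sin (\<xi>1 u) > 0" if "u \<in> I" for u using D(8)[OF that] by (simp add: B34_def sin_gt_zero)
  then show "continuous_on I (\<lambda>u. b * deriv \<xi>2 u)" "continuous_on I (\<lambda>u. 1 / (sin (\<xi>1 u))\<^sup>2 + b\<^sup>2)"
    using D by (force intro!: continuous_intros)+
qed

text \<open>The computation for X24 with sin \<xi>1 in place of \<xi>2; F = b \<xi>2' now has the
  opposite sign, which produces the minus in front of b.\<close>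

lemma integrand_X34:
  assumes u: "u \<in> I" and w: "w = deriv \<xi>2 u * (sin (\<xi>1 u) / sqrt (1 + b\<^sup>2 * (sin (\<xi>1 u))\<^sup>2))"
  shows "(- b * w + \<epsilon> * cot \<theta>) * sin (\<xi>1 u) / sqrt (1 + b\<^sup>2 * (sin (\<xi>1 u))\<^sup>2) =
    \<epsilon> * cot \<theta> / sqrt (1 / (sin (\<xi>1 u))\<^sup>2 + b\<^sup>2) - (b * deriv \<xi>2 u) / (1 / (sin (\<xi>1 u))\<^sup>2 + b\<^sup>2)"
proof -
  have p: "sin (\<xi>1 u) > 0" using invariant_surfaceD(8)[OF surf u] by (simp add: B34_def sin_gt_zero)
  define q where "q = sqrt (1 + b\<^sup>2 * (sin (\<xi>1 u))\<^sup>2)"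
  have q: "q > 0" "q\<^sup>2 = 1 + b\<^sup>2 * (sin (\<xi>1 u))\<^sup>2" by (simp_all add: q_def add_pos_nonneg)
  have G: "1 / (sin (\<xi>1 u))\<^sup>2 + b\<^sup>2 = (q / sin (\<xi>1 u))\<^sup>2" using p by (simp add: q(2) power_divide field_simps)
  from p q(1) have G': "sqrt (1 / (sin (\<xi>1 u))\<^sup>2 + b\<^sup>2) = q / sin (\<xi>1 u)" unfolding G by simp
  show ?thesis
    unfolding G' unfolding G w q_def[symmetric] using p q(1)
    by (simp add: field_simps power2_eq_square)
qed

lemma sqrt_X34:
  assumes u: "u \<in> I"
  shows "sgn (deriv \<xi>2 u) * sqrt ((sin (\<xi>1 u))\<^sup>2 - (deriv \<xi>1 u)\<^sup>2)
      = deriv \<xi>2 u * (sin (\<xi>1 u) / sqrt (1 + b\<^sup>2 * (sin (\<xi>1 u))\<^sup>2))"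
    and "deriv \<xi>2 u \<ge> 0 \<Longrightarrow> sqrt ((sin (\<xi>1 u))\<^sup>2 - (deriv \<xi>1 u)\<^sup>2)
      = deriv \<xi>2 u * (sin (\<xi>1 u) / sqrt (1 + b\<^sup>2 * (sin (\<xi>1 u))\<^sup>2))"
proof -
  have p: "sin (\<xi>1 u) > 0" using invariant_surfaceD(8)[OF surf u] by (simp add: B34_def sin_gt_zero)
  define q where "q = sqrt (1 + b\<^sup>2 * (sin (\<xi>1 u))\<^sup>2)"
  have q: "q > 0" "q\<^sup>2 = 1 + b\<^sup>2 * (sin (\<xi>1 u))\<^sup>2" by (simp_all add: q_def add_pos_nonneg)
  have "(deriv \<xi>1 u)\<^sup>2 / (sin (\<xi>1 u))\<^sup>2 + (deriv \<xi>2 u)\<^sup>2 / q\<^sup>2 = 1"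
    using invariant_surfaceD(9)[OF surf u] by (simp add: quot34_def q(2))
  then have "(sin (\<xi>1 u))\<^sup>2 - (deriv \<xi>1 u)\<^sup>2 = (deriv \<xi>2 u * (sin (\<xi>1 u) / q))\<^sup>2"
    using p q(1) by (simp add: field_simps)
  from sgn_times_sqrt[OF this] p q(1)
  show "sgn (deriv \<xi>2 u) * sqrt ((sin (\<xi>1 u))\<^sup>2 - (deriv \<xi>1 u)\<^sup>2)
      = deriv \<xi>2 u * (sin (\<xi>1 u) / sqrt (1 + b\<^sup>2 * (sin (\<xi>1 u))\<^sup>2))"
    and "deriv \<xi>2 u \<ge> 0 \<Longrightarrow> sqrt ((sin (\<xi>1 u))\<^sup>2 - (deriv \<xi>1 u)\<^sup>2)
      = deriv \<xi>2 u * (sin (\<xi>1 u) / sqrt (1 + b\<^sup>2 * (sin (\<xi>1 u))\<^sup>2))"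
    unfolding q_def[symmetric] by simp_all
qed

end

section \<open>Surfaces invariant under X14\<close>

context
  fixes b :: real and M :: "pt set" and I :: "real set" and \<xi>1 \<xi>2 :: "real \<Rightarrow> real"
  assumes surf: "invariant_surface (X14 b) (orbit14 b) B14_reg (quot14 b) M I \<xi>1 \<xi>2"
begin

lemma xi1_X14:
  assumes "u \<in> I"
  shows "\<xi>1 u > 2" "\<xi>1 u \<ge> 2" "(\<xi>1 u)\<^sup>2 - 4 > 0"
proof -
  show g: "\<xi>1 u > 2" using invariant_surfaceD(8)[OF surf assms] by (simp add: B14_reg_def)
  then show "\<xi>1 u \<ge> 2" by simp
  show "(\<xi>1 u)\<^sup>2 - 4 > 0" using power_strict_mono[OF g, of 2] by simp
qed

lemma surface_parametrization_X14:
  "surface_parametrization (X14 b) (orbit14 b) M I \<xi>1 \<xi>2 (\<lambda>u v. polar14 (\<xi>1 u) v (\<xi>2 u + b * v))"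
proof (rule complete_flow.surface_parametrizationI[OF complete_flow_X14 surf])
  fix u assume u: "u \<in> I"
  note g = xi1_X14(2)[OF u]
  show "polar14 (\<xi>1 u) 0 (\<xi>2 u + b * 0) \<in> H2R" by (rule polar14_in[OF g])
  show "polar14 (\<xi>1 u) v (\<xi>2 u + b * v) = flow (X14 b) v (polar14 (\<xi>1 u) 0 (\<xi>2 u + b * 0))" for v
    by (simp add: flow_polar14[OF g])
  show "orbit14 b (\<xi>1 u, \<xi>2 u) = orbit (X14 b) (polar14 (\<xi>1 u) 0 (\<xi>2 u + b * 0))"
    by (simp add: orbit14_eq section14_eq[OF g])
qed

text \<open>In polar coordinates the horizontal part of the u-derivative is radial, of squared
  length \<xi>1'^2 / (\<xi>1^2 - 4), and X1 is angular, of squared length (\<xi>1^2 - 4) / 4. Only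
  the vertical components \<xi>2' and b contribute to F. S is the polar radius in the (a, d)-plane
  and N the common denominator of the u-derivative.\<close>

lemma invariant_immersion_X14:
  defines "S \<equiv> \<lambda>u. sqrt ((\<xi>1 u)\<^sup>2 - 4)"
  defines "N \<equiv> \<lambda>u v. S u * (\<xi>1 u - S u * cos v)\<^sup>2"
  shows "invariant_immersion (X14 b) (\<lambda>u v. polar14 (\<xi>1 u) v (\<xi>2 u + b * v))
     (\<lambda>u v. (- 4 * sin v * deriv \<xi>1 u / N u v, 2 * (\<xi>1 u * cos v - S u) * deriv \<xi>1 u / N u v, deriv \<xi>2 u)) I
     (\<lambda>u. (deriv \<xi>1 u)\<^sup>2 / ((\<xi>1 u)\<^sup>2 - 4) + (deriv \<xi>2 u)\<^sup>2)
     (\<lambda>u. b * deriv \<xi>2 u) (\<lambda>u. ((\<xi>1 u)\<^sup>2 - 4) / 4 + b\<^sup>2)"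
proof
  note D = invariant_surfaceD[OF surf]
  show "open_interval I" by (rule D)
  have S: "S u > 0" "(S u)\<^sup>2 = (\<xi>1 u)\<^sup>2 - 4" if "u \<in> I" for u
    using xi1_X14(3)[OF that] by (simp_all add: S_def)
  have sc: "(sin v)\<^sup>2 = 1 - (cos v)\<^sup>2" for v :: real by (rule sin_squared_eq)
  have pos: "\<xi>1 u - S u * cos v > 0" if "u \<in> I" for u v
    using hyperboloid_less[OF polar_hyperboloid[OF xi1_X14(2)[OF that]]] by (simp add: S_def)
  have polar: "polar14 (\<xi>1 u) v z = (S u * sin v / (S u * cos v - \<xi>1 u), 2 / (\<xi>1 u - S u * cos v), z)" for u v z
    by (simp add: polar14_def hyperboloid_pt_def S_def)
  have X: "X14 b (polar14 (\<xi>1 u) v z) =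
      (((S u)\<^sup>2 - S u * cos v * \<xi>1 u) / (\<xi>1 u - S u * cos v)\<^sup>2,
       - 2 * (S u * sin v) / (\<xi>1 u - S u * cos v)\<^sup>2, b)" if "u \<in> I" for u v z
  proof -
    have "(S u * cos v)\<^sup>2 + (S u * sin v)\<^sup>2 = (S u)\<^sup>2"
      by (simp add: power_mult_distrib sc algebra_simps)
    then show ?thesis
      unfolding polar14_def X14_hyperboloid_pt[OF polar_hyperboloid[OF xi1_X14(2)[OF that]]] S_def by simp
  qed
  show "flow (X14 b) c (polar14 (\<xi>1 u) v (\<xi>2 u + b * v)) = polar14 (\<xi>1 u) (v + c) (\<xi>2 u + b * (v + c))"
    if "u \<in> I" for u v c
    using flow_polar14[OF xi1_X14(2)[OF that]] by (simp add: algebra_simps)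
  show "((\<lambda>s. polar14 (\<xi>1 (h s)) (k s) (\<xi>2 (h s) + b * k s)) has_vector_derivative
      (h' *\<^sub>R (- 4 * sin (k s) * deriv \<xi>1 (h s) / N (h s) (k s),
         2 * (\<xi>1 (h s) * cos (k s) - S (h s)) * deriv \<xi>1 (h s) / N (h s) (k s), deriv \<xi>2 (h s))
        + k' *\<^sub>R X14 b (polar14 (\<xi>1 (h s)) (k s) (\<xi>2 (h s) + b * k s)))) (at s)"
    if s: "h s \<in> I" and h: "(h has_real_derivative h') (at s)" and k: "(k has_real_derivative k') (at s)"
    for h k s h' k'
  proof -
    define \<xi> \<sigma> d c n where "\<xi> = \<xi>1 (h s)" and "\<sigma> = S (h s)" and "d = deriv \<xi>1 (h s)"
      and "c = cos (k s)" and "n = sin (k s)"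
    have \<sigma>: "\<sigma> > 0" "\<sigma>\<^sup>2 = \<xi>\<^sup>2 - 4" and n2: "n\<^sup>2 = 1 - c\<^sup>2" and q: "\<xi> - \<sigma> * c > 0"
      using S[OF s] sc pos[OF s] by (simp_all add: \<xi>_def \<sigma>_def c_def n_def)
    have x: "((\<lambda>s. \<xi>1 (h s)) has_real_derivative d * h') (at s)"
      using DERIV_chain2[OF D(2)[OF s] h] by (simp add: d_def)
    have "((\<lambda>s. (\<xi>1 (h s))\<^sup>2 - 4) has_real_derivative 2 * (d * h' * \<xi>)) (at s)"
      using DERIV_diff[OF DERIV_power[OF x, of 2] DERIV_const[of 4]] by (simp add: \<xi>_def)
    from DERIV_chain2[OF DERIV_real_sqrt[OF xi1_X14(3)[OF s]] this]
    have "((\<lambda>s. S (h s)) has_real_derivative inverse \<sigma> / 2 * (2 * (d * h' * \<xi>))) (at s)"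
      unfolding S_def \<sigma>_def .
    moreover have "inverse \<sigma> / 2 * (2 * (d * h' * \<xi>)) = \<xi> * d * h' / \<sigma>"
      using \<sigma>(1) by (simp add: field_simps)
    ultimately have S': "((\<lambda>s. S (h s)) has_real_derivative \<xi> * d * h' / \<sigma>) (at s)" by simp
    have c': "((\<lambda>s. cos (k s)) has_real_derivative - n * k') (at s)"
      and n': "((\<lambda>s. sin (k s)) has_real_derivative c * k') (at s)"
      using DERIV_chain2[OF DERIV_cos k] DERIV_chain2[OF DERIV_sin k] by (simp_all add: c_def n_def)
    have a: "((\<lambda>s. S (h s) * cos (k s)) has_real_derivative \<xi> * d * h' / \<sigma> * c - \<sigma> * n * k') (at s)"
      using DERIV_mult[OF S' c'] by (simp add: c_def \<sigma>_def algebra_simps)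
    have e: "((\<lambda>s. S (h s) * sin (k s)) has_real_derivative \<xi> * d * h' / \<sigma> * n + \<sigma> * c * k') (at s)"
      using DERIV_mult[OF S' n'] by (simp add: n_def \<sigma>_def algebra_simps)
    have "((\<lambda>s. S (h s) * sin (k s) / (S (h s) * cos (k s) - \<xi>1 (h s))) has_real_derivative
       ((\<xi> * d * h' / \<sigma> * n + \<sigma> * c * k') * (\<sigma> * c - \<xi>) -
        \<sigma> * n * (\<xi> * d * h' / \<sigma> * c - \<sigma> * n * k' - d * h')) / ((\<sigma> * c - \<xi>) * (\<sigma> * c - \<xi>))) (at s)"
      using DERIV_divide[OF e DERIV_diff[OF a x]] q by (simp add: \<sigma>_def n_def c_def \<xi>_def)
    moreover have "((\<xi> * d * h' / \<sigma> * n + \<sigma> * c * k') * (\<sigma> * c - \<xi>) -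
        \<sigma> * n * (\<xi> * d * h' / \<sigma> * c - \<sigma> * n * k' - d * h')) / ((\<sigma> * c - \<xi>) * (\<sigma> * c - \<xi>))
      = h' * (- 4 * n * d / (\<sigma> * (\<xi> - \<sigma> * c)\<^sup>2)) + k' * ((\<sigma>\<^sup>2 - \<sigma> * c * \<xi>) / (\<xi> - \<sigma> * c)\<^sup>2)"
    proof -
      \<comment> \<open>The h' part collapses by \<sigma>^2 - \<xi>^2 = -4 and the k' part by c^2 +
        n^2 = 1.\<close>
      have "(\<xi> * d * h' / \<sigma> * n + \<sigma> * c * k') * (\<sigma> * c - \<xi>) -
          \<sigma> * n * (\<xi> * d * h' / \<sigma> * c - \<sigma> * n * k' - d * h')
        = (d * h' * n * (\<sigma>\<^sup>2 - \<xi>\<^sup>2) + k' * \<sigma> * (\<sigma>\<^sup>2 * (c\<^sup>2 + n\<^sup>2) - \<sigma> * c * \<xi>)) / \<sigma>"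
        using \<sigma>(1) by (simp add: field_simps power2_eq_square)
      also have "\<dots> = h' * (- 4 * n * d / \<sigma>) + k' * (\<sigma>\<^sup>2 - \<sigma> * c * \<xi>)"
        using \<sigma>(1) by (simp add: \<sigma>(2) n2 diff_divide_distrib)
      finally have "(\<xi> * d * h' / \<sigma> * n + \<sigma> * c * k') * (\<sigma> * c - \<xi>) -
          \<sigma> * n * (\<xi> * d * h' / \<sigma> * c - \<sigma> * n * k' - d * h')
        = h' * (- 4 * n * d / \<sigma>) + k' * (\<sigma>\<^sup>2 - \<sigma> * c * \<xi>)" .
      moreover have "(\<sigma> * c - \<xi>) * (\<sigma> * c - \<xi>) = (\<xi> - \<sigma> * c)\<^sup>2"
        by (simp add: power2_eq_square algebra_simps)
      ultimately show ?thesis by (simp only: add_divide_distrib times_divide_eq_right divide_divide_eq_left)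
    qed
    ultimately have 1: "((\<lambda>s. S (h s) * sin (k s) / (S (h s) * cos (k s) - \<xi>1 (h s))) has_real_derivative
       h' * (- 4 * n * d / (\<sigma> * (\<xi> - \<sigma> * c)\<^sup>2)) + k' * ((\<sigma>\<^sup>2 - \<sigma> * c * \<xi>) / (\<xi> - \<sigma> * c)\<^sup>2)) (at s)" by simp
    have "((\<lambda>s. 2 / (\<xi>1 (h s) - S (h s) * cos (k s))) has_real_derivative
       (0 * (\<xi> - \<sigma> * c) - 2 * (d * h' - (\<xi> * d * h' / \<sigma> * c - \<sigma> * n * k'))) / ((\<xi> - \<sigma> * c) * (\<xi> - \<sigma> * c))) (at s)"
      using DERIV_divide[OF DERIV_const[of 2] DERIV_diff[OF x a]] q by (simp add: \<sigma>_def c_def \<xi>_def)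
    moreover have "(0 * (\<xi> - \<sigma> * c) - 2 * (d * h' - (\<xi> * d * h' / \<sigma> * c - \<sigma> * n * k'))) / ((\<xi> - \<sigma> * c) * (\<xi> - \<sigma> * c))
      = h' * (2 * (\<xi> * c - \<sigma>) * d / (\<sigma> * (\<xi> - \<sigma> * c)\<^sup>2)) + k' * (- 2 * (\<sigma> * n) / (\<xi> - \<sigma> * c)\<^sup>2)"
    proof -
      have "0 * (\<xi> - \<sigma> * c) - 2 * (d * h' - (\<xi> * d * h' / \<sigma> * c - \<sigma> * n * k'))
        = h' * (2 * (\<xi> * c - \<sigma>) * d / \<sigma>) + k' * (- 2 * (\<sigma> * n))"
        using \<sigma>(1) by (simp add: field_simps)
      then show ?thesis
        by (simp only: add_divide_distrib times_divide_eq_right divide_divide_eq_left power2_eq_square)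
    qed
    ultimately have 2: "((\<lambda>s. 2 / (\<xi>1 (h s) - S (h s) * cos (k s))) has_real_derivative
       h' * (2 * (\<xi> * c - \<sigma>) * d / (\<sigma> * (\<xi> - \<sigma> * c)\<^sup>2)) + k' * (- 2 * (\<sigma> * n) / (\<xi> - \<sigma> * c)\<^sup>2)) (at s)" by simp
    have 3: "((\<lambda>s. \<xi>2 (h s) + b * k s) has_real_derivative h' * deriv \<xi>2 (h s) + k' * b) (at s)"
      using DERIV_add[OF DERIV_chain2[OF D(3)[OF s] h] DERIV_cmult[OF k, of b]] by (simp add: mult.commute)
    show ?thesis
      unfolding X[OF s] unfolding polar N_def scaleR_Pair add_Pair
        has_vector_derivative_triple_iff real_scaleR_def
      using 1 2 3 unfolding \<xi>_def \<sigma>_def d_def c_def n_def by blast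
  qed
  fix u assume u: "u \<in> I"
  define \<sigma> where "\<sigma> = S u"
  have \<sigma>: "\<sigma> > 0" "\<sigma>\<^sup>2 = (\<xi>1 u)\<^sup>2 - 4" using S[OF u] by (simp_all add: \<sigma>_def)
  have q: "\<xi>1 u - \<sigma> * cos v > 0" for v using pos[OF u] by (simp add: \<sigma>_def)
  \<comment> \<open>This identity, a consequence of \<sigma>^2 = \<xi>1^2 - 4, removes the angle v
    from the lengths of both the u-derivative and X1: its right side is 4 / y^2.\<close>
  have key: "4 * (sin v)\<^sup>2 + (\<xi>1 u * cos v - \<sigma>)\<^sup>2 = (\<xi>1 u - \<sigma> * cos v)\<^sup>2" for v
    using \<sigma>(2) sc[of v] by algebra
  have met: "metric (polar14 (\<xi>1 u) v z) (a1, a2, a3) (c1, c2, c3)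
      = (a1 * c1 + a2 * c2) * (\<xi>1 u - \<sigma> * cos v)\<^sup>2 / 4 + a3 * c3" for v z a1 a2 a3 c1 c2 c3
    unfolding polar \<sigma>_def[symmetric] using q[of v] by (simp add: metric_def power_divide)
  note X' = X[OF u, folded \<sigma>_def]
  show "metric (polar14 (\<xi>1 u) v (\<xi>2 u + b * v))
      (- 4 * sin v * deriv \<xi>1 u / N u v, 2 * (\<xi>1 u * cos v - S u) * deriv \<xi>1 u / N u v, deriv \<xi>2 u)
      (- 4 * sin v * deriv \<xi>1 u / N u v, 2 * (\<xi>1 u * cos v - S u) * deriv \<xi>1 u / N u v, deriv \<xi>2 u)
      = (deriv \<xi>1 u)\<^sup>2 / ((\<xi>1 u)\<^sup>2 - 4) + (deriv \<xi>2 u)\<^sup>2" for v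
  proof -
    define r where "r = \<xi>1 u - \<sigma> * cos v"
    have r: "r \<noteq> 0" using q[of v] by (simp add: r_def)
    define m where "m = deriv \<xi>1 u"
    have "(- 4 * sin v * m / (\<sigma> * r\<^sup>2)) * (- 4 * sin v * m / (\<sigma> * r\<^sup>2)) +
        (2 * (\<xi>1 u * cos v - \<sigma>) * m / (\<sigma> * r\<^sup>2)) * (2 * (\<xi>1 u * cos v - \<sigma>) * m / (\<sigma> * r\<^sup>2))
      = (4 * m\<^sup>2 * (4 * (sin v)\<^sup>2 + (\<xi>1 u * cos v - \<sigma>)\<^sup>2)) / (\<sigma> * r\<^sup>2)\<^sup>2"
      by (simp only: times_divide_times_eq power2_eq_square[of "\<sigma> * r\<^sup>2"] flip: add_divide_distrib)
         (simp add: power2_eq_square algebra_simps)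
    also have "\<dots> = 4 * m\<^sup>2 / (\<sigma>\<^sup>2 * r\<^sup>2)"
      unfolding key r_def[symmetric] using r by (simp add: power2_eq_square)
    finally show ?thesis
      unfolding met N_def \<sigma>_def[symmetric] r_def[symmetric] m_def[symmetric] \<sigma>(2)[symmetric]
      using r by (simp add: power2_eq_square)
  qed
  show "metric (polar14 (\<xi>1 u) v (\<xi>2 u + b * v))
      (- 4 * sin v * deriv \<xi>1 u / N u v, 2 * (\<xi>1 u * cos v - S u) * deriv \<xi>1 u / N u v, deriv \<xi>2 u)
      (X14 b (polar14 (\<xi>1 u) v (\<xi>2 u + b * v))) = b * deriv \<xi>2 u" for v
  proof -
    define r where "r = \<xi>1 u - \<sigma> * cos v"
    define m where "m = deriv \<xi>1 u"
    \<comment> \<open>The radial and the angular direction are orthogonal.\<close>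
    have "(- 4 * sin v * m / (\<sigma> * r\<^sup>2)) * ((\<sigma>\<^sup>2 - \<sigma> * cos v * \<xi>1 u) / r\<^sup>2) +
        (2 * (\<xi>1 u * cos v - \<sigma>) * m / (\<sigma> * r\<^sup>2)) * (- 2 * (\<sigma> * sin v) / r\<^sup>2) = 0"
      by (simp only: times_divide_times_eq flip: add_divide_distrib)
         (simp add: power2_eq_square algebra_simps)
    then show ?thesis
      unfolding X' met N_def \<sigma>_def[symmetric] r_def[symmetric] m_def[symmetric] by simp
  qed
  show "metric (polar14 (\<xi>1 u) v (\<xi>2 u + b * v))
      (X14 b (polar14 (\<xi>1 u) v (\<xi>2 u + b * v))) (X14 b (polar14 (\<xi>1 u) v (\<xi>2 u + b * v)))
      = ((\<xi>1 u)\<^sup>2 - 4) / 4 + b\<^sup>2" for v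
  proof -
    define r where "r = \<xi>1 u - \<sigma> * cos v"
    have r: "r \<noteq> 0" using q[of v] by (simp add: r_def)
    have "((\<sigma>\<^sup>2 - \<sigma> * cos v * \<xi>1 u) / r\<^sup>2) * ((\<sigma>\<^sup>2 - \<sigma> * cos v * \<xi>1 u) / r\<^sup>2) +
        (- 2 * (\<sigma> * sin v) / r\<^sup>2) * (- 2 * (\<sigma> * sin v) / r\<^sup>2)
      = \<sigma>\<^sup>2 * (4 * (sin v)\<^sup>2 + (\<xi>1 u * cos v - \<sigma>)\<^sup>2) / (r\<^sup>2 * r\<^sup>2)"
      by (simp only: times_divide_times_eq flip: add_divide_distrib)
         (simp add: power2_eq_square algebra_simps)
    also have "\<dots> = \<sigma>\<^sup>2 / r\<^sup>2"
      unfolding key r_def[symmetric] using r by (simp add: power2_eq_square)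
    finally show ?thesis
      unfolding X' met r_def[symmetric] \<sigma>(2)[symmetric] using r by (simp add: power2_eq_square)
  qed
  show G: "((\<xi>1 u)\<^sup>2 - 4) / 4 + b\<^sup>2 > 0" using xi1_X14(3)[OF u] by (simp add: add_pos_nonneg)
  \<comment> \<open>Q is 4 G and is the radicand in the formula for v; Q - 4 b^2 = \<xi>1^2 - 4 then
    yields the \<xi>2' coefficient of \<open>quot14\<close>.\<close>
  define Q where "Q = (\<xi>1 u)\<^sup>2 + 4 * (b\<^sup>2 - 1)"
  have Q: "Q > 0" and G': "((\<xi>1 u)\<^sup>2 - 4) / 4 + b\<^sup>2 = Q / 4" using G by (simp_all add: Q_def field_simps)
  have "(deriv \<xi>2 u)\<^sup>2 - (b * deriv \<xi>2 u)\<^sup>2 / (Q / 4) = (Q - 4 * b\<^sup>2) / Q * (deriv \<xi>2 u)\<^sup>2"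
    using Q by (simp add: field_simps power2_eq_square)
  moreover have "Q - 4 * b\<^sup>2 = (\<xi>1 u)\<^sup>2 - 4" by (simp add: Q_def)
  ultimately show "(deriv \<xi>1 u)\<^sup>2 / ((\<xi>1 u)\<^sup>2 - 4) + (deriv \<xi>2 u)\<^sup>2
      - (b * deriv \<xi>2 u)\<^sup>2 / (((\<xi>1 u)\<^sup>2 - 4) / 4 + b\<^sup>2) = 1"
    unfolding G' using D(9)[OF u] by (simp add: quot14_def Q_def)
next
  show "continuous_on I (\<lambda>u. b * deriv \<xi>2 u)" "continuous_on I (\<lambda>u. ((\<xi>1 u)\<^sup>2 - 4) / 4 + b\<^sup>2)"
    using invariant_surfaceD(4,7)[OF surf] by (intro continuous_intros; simp)+
qed

lemma Q_X14:
  assumes "u \<in> I"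
  defines "Q \<equiv> (\<xi>1 u)\<^sup>2 + 4 * (b\<^sup>2 - 1)"
  shows "Q > 0" "((\<xi>1 u)\<^sup>2 - 4) / 4 + b\<^sup>2 = (sqrt Q / 2)\<^sup>2"
proof -
  have "4 * b\<^sup>2 \<ge> 0" by simp
  then show Q: "Q > 0" using xi1_X14(3)[OF assms(1)] unfolding Q_def right_diff_distrib by linarith
  show "((\<xi>1 u)\<^sup>2 - 4) / 4 + b\<^sup>2 = (sqrt Q / 2)\<^sup>2"
    using Q by (simp add: power_divide) (simp add: Q_def field_simps)
qed

text \<open>Here sqrt G = q / 2, the source of the constants 2 and 4; numerator and denominator are
  expanded by T = \<xi>1^2 - 4 because w = \<xi>2' T / q carries that factor.\<close>

lemma integrand_X14:
  assumes u: "u \<in> I" and w: "w = deriv \<xi>2 u * (((\<xi>1 u)\<^sup>2 - 4) / sqrt ((\<xi>1 u)\<^sup>2 + 4 * (b\<^sup>2 - 1)))"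
  shows "(- 4 * b * w + \<epsilon> * (2 * ((\<xi>1 u)\<^sup>2 - 4) * cot \<theta>))
      / (((\<xi>1 u)\<^sup>2 - 4) * sqrt ((\<xi>1 u)\<^sup>2 + 4 * (b\<^sup>2 - 1))) =
    \<epsilon> * cot \<theta> / sqrt (((\<xi>1 u)\<^sup>2 - 4) / 4 + b\<^sup>2) - (b * deriv \<xi>2 u) / (((\<xi>1 u)\<^sup>2 - 4) / 4 + b\<^sup>2)"
proof -
  define T q where "T = (\<xi>1 u)\<^sup>2 - 4" and "q = sqrt ((\<xi>1 u)\<^sup>2 + 4 * (b\<^sup>2 - 1))"
  have T: "T > 0" using xi1_X14(3)[OF u] by (simp add: T_def)
  have q: "q > 0" and G: "T / 4 + b\<^sup>2 = (q / 2)\<^sup>2" using Q_X14[OF u] by (simp_all add: q_def T_def)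
  have G': "sqrt (T / 4 + b\<^sup>2) = q / 2" unfolding G using q by simp
  show ?thesis
    unfolding w T_def[symmetric] q_def[symmetric] G' unfolding G using T q
    by (simp add: field_simps power2_eq_square)
qed

lemma sqrt_X14:
  assumes u: "u \<in> I"
  shows "sgn (deriv \<xi>2 u) * sqrt ((\<xi>1 u)\<^sup>2 - 4 - (deriv \<xi>1 u)\<^sup>2)
      = deriv \<xi>2 u * (((\<xi>1 u)\<^sup>2 - 4) / sqrt ((\<xi>1 u)\<^sup>2 + 4 * (b\<^sup>2 - 1)))"
    and "deriv \<xi>2 u \<ge> 0 \<Longrightarrow> sqrt ((\<xi>1 u)\<^sup>2 - 4 - (deriv \<xi>1 u)\<^sup>2)
      = deriv \<xi>2 u * (((\<xi>1 u)\<^sup>2 - 4) / sqrt ((\<xi>1 u)\<^sup>2 + 4 * (b\<^sup>2 - 1)))"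
proof -
  define T q where "T = (\<xi>1 u)\<^sup>2 - 4" and "q = sqrt ((\<xi>1 u)\<^sup>2 + 4 * (b\<^sup>2 - 1))"
  have T: "T > 0" using xi1_X14(3)[OF u] by (simp add: T_def)
  have q: "q > 0" "q\<^sup>2 = (\<xi>1 u)\<^sup>2 + 4 * (b\<^sup>2 - 1)" using Q_X14(1)[OF u] by (simp_all add: q_def)
  have "(deriv \<xi>1 u)\<^sup>2 / T + T / q\<^sup>2 * (deriv \<xi>2 u)\<^sup>2 = 1"
    using invariant_surfaceD(9)[OF surf u] by (simp add: quot14_def q(2) T_def)
  then have "T * ((deriv \<xi>1 u)\<^sup>2 / T + T / q\<^sup>2 * (deriv \<xi>2 u)\<^sup>2) = T" by simp
  then have "T - (deriv \<xi>1 u)\<^sup>2 = (deriv \<xi>2 u * (T / q))\<^sup>2"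
    using T q(1) by (simp add: power_mult_distrib power_divide distrib_left power2_eq_square[of T] mult.commute)
  from sgn_times_sqrt[OF this] T q(1)
  show "sgn (deriv \<xi>2 u) * sqrt ((\<xi>1 u)\<^sup>2 - 4 - (deriv \<xi>1 u)\<^sup>2)
      = deriv \<xi>2 u * (((\<xi>1 u)\<^sup>2 - 4) / sqrt ((\<xi>1 u)\<^sup>2 + 4 * (b\<^sup>2 - 1)))"
    and "deriv \<xi>2 u \<ge> 0 \<Longrightarrow> sqrt ((\<xi>1 u)\<^sup>2 - 4 - (deriv \<xi>1 u)\<^sup>2)
      = deriv \<xi>2 u * (((\<xi>1 u)\<^sup>2 - 4) / sqrt ((\<xi>1 u)\<^sup>2 + 4 * (b\<^sup>2 - 1)))"
    unfolding q_def[symmetric] T_def[symmetric] by simp_all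
qed

end

section \<open>The case b = 0 and the assembly of all cases\<close>

lemma loxodromes_X2:
  fixes \<theta> u0 :: real
  assumes \<theta>: "0 < \<theta>" "\<theta> < pi" "u0 \<in> I"
    and "invariant_surface X2 (level (inv24 0)) B24 (quot24 0) M I \<xi>1 \<xi>2"
  shows "loxodromes_given_by X2 (\<lambda>u v. (v, \<xi>2 u, - \<xi>1 u)) I \<theta>
    (\<lambda>\<epsilon> u. (\<epsilon> * cot \<theta> * (LBINT t=u0..u. \<xi>2 t), \<xi>2 u, - \<xi>1 u))"
proof -
  have X2: "X24 0 = X2" by (simp add: X24_def fun_eq_iff)
  then have surf: "invariant_surface (X24 0) (level (inv24 0)) B24 (quot24 0) M I \<xi>1 \<xi>2"
    using assms by simp
  \<comment> \<open>For b = 0 the root term vanishes from the integrand, so no orientation of the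
    profile curve has to be assumed.\<close>
  have "loxodromes_given_by (X24 0) (\<lambda>u v. (v, \<xi>2 u, 0 * v - \<xi>1 u)) I \<theta>
    (\<lambda>\<epsilon> u. ((LBINT t=u0..u. \<epsilon> * cot \<theta> * \<xi>2 t), \<xi>2 u, 0 * (LBINT t=u0..u. \<epsilon> * cot \<theta> * \<xi>2 t) - \<xi>1 u))"
    by (rule invariant_immersion.loxodromes_given_by_integral[OF invariant_immersion_X24[OF surf] \<theta>])
       (use integrand_X24[OF surf _ refl] in simp)
  then show ?thesis by (simp add: X2)
qed

theorem theorem4p2:
  fixes b \<theta> u0 :: real
    and M :: "pt set"
    and I :: "real set"
    and \<xi>1 \<xi>2 :: "real \<Rightarrow> real"
  assumes "0 < \<theta>" and "\<theta> < pi" and "u0 \<in> I"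
  shows
    "(orbit_space_is (X24 b) (inv24 b) B24 \<and>
     (invariant_surface (X24 b) (level (inv24 b)) B24 (quot24 b) M I \<xi>1 \<xi>2 \<longrightarrow>
       (let \<psi> = (\<lambda>u v. (v, \<xi>2 u, b * v - \<xi>1 u)) in
         surface_parametrization (X24 b) (level (inv24 b)) M I \<xi>1 \<xi>2 \<psi> \<and>
         ((\<forall>u\<in>I. deriv \<xi>1 u \<ge> 0) \<longrightarrow>
           loxodromes_given_by (X24 b) \<psi> I \<theta> (\<lambda>\<epsilon> u. \<psi> u
             (LBINT t=u0..u. (b * sqrt ((\<xi>2 t)\<^sup>2 - (deriv \<xi>2 t)\<^sup>2) + \<epsilon> * cot \<theta>) * \<xi>2 t
                / sqrt (1 + b\<^sup>2 * (\<xi>2 t)\<^sup>2)))) \<and>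
         loxodromes_given_by (X24 b) \<psi> I \<theta> (\<lambda>\<epsilon> u. \<psi> u
             (LBINT t=u0..u. (b * (sgn (deriv \<xi>1 t) * sqrt ((\<xi>2 t)\<^sup>2 - (deriv \<xi>2 t)\<^sup>2)) + \<epsilon> * cot \<theta>) * \<xi>2 t
                / sqrt (1 + b\<^sup>2 * (\<xi>2 t)\<^sup>2))))) \<and>
     (invariant_surface X2 (level (inv24 0)) B24 (quot24 0) M I \<xi>1 \<xi>2 \<longrightarrow>
       loxodromes_given_by X2 (\<lambda>u v. (v, \<xi>2 u, - \<xi>1 u)) I \<theta>
         (\<lambda>\<epsilon> u. (\<epsilon> * cot \<theta> * (LBINT t=u0..u. \<xi>2 t), \<xi>2 u, - \<xi>1 u)))) \<and>
     (invariant_surface X4 (level inv4) B24 quot4 M I \<xi>1 \<xi>2 \<longrightarrow>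
       (let \<psi> = (\<lambda>u v. (\<xi>1 u, \<xi>2 u, v)) in
         surface_parametrization X4 (level inv4) M I \<xi>1 \<xi>2 \<psi> \<and>
         M = {(x, y, z). (x, y) \<in> (\<lambda>u. (\<xi>1 u, \<xi>2 u)) ` I} \<and>
         (\<forall>J \<alpha>. loxodrome X4 \<psi> I \<theta> J \<alpha> \<longrightarrow> helix J \<alpha>) \<and>
         loxodromes_given_by X4 \<psi> I \<theta>
           (\<lambda>\<epsilon> u. (\<xi>1 u, \<xi>2 u, \<epsilon> * cot \<theta> * (u - u0))))) \<and>
     (orbit_space_is (X34 b) (inv34 b) B34 \<and>
     (invariant_surface (X34 b) (level (inv34 b)) B34 (quot34 b) M I \<xi>1 \<xi>2 \<longrightarrow>
       (let \<psi> = (\<lambda>u v. (exp v * cos (\<xi>1 u), exp v * sin (\<xi>1 u), \<xi>2 u + b * v)) in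
         surface_parametrization (X34 b) (level (inv34 b)) M I \<xi>1 \<xi>2 \<psi> \<and>
         ((\<forall>u\<in>I. deriv \<xi>2 u \<ge> 0) \<longrightarrow>
           loxodromes_given_by (X34 b) \<psi> I \<theta> (\<lambda>\<epsilon> u. \<psi> u
             (LBINT t=u0..u. (- b * sqrt ((sin (\<xi>1 t))\<^sup>2 - (deriv \<xi>1 t)\<^sup>2) + \<epsilon> * cot \<theta>) * sin (\<xi>1 t)
                / sqrt (1 + b\<^sup>2 * (sin (\<xi>1 t))\<^sup>2)))) \<and>
         loxodromes_given_by (X34 b) \<psi> I \<theta> (\<lambda>\<epsilon> u. \<psi> u
             (LBINT t=u0..u. (- b * (sgn (deriv \<xi>2 t) * sqrt ((sin (\<xi>1 t))\<^sup>2 - (deriv \<xi>1 t)\<^sup>2)) + \<epsilon> * cot \<theta>) * sin (\<xi>1 t)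
                / sqrt (1 + b\<^sup>2 * (sin (\<xi>1 t))\<^sup>2)))))) \<and>
     (orbit_space_represented_by (X14 b) (orbit14 b) B14 \<and>
     (\<forall>\<xi>\<in>B14. \<forall>p\<in>orbit14 b \<xi>. xi14 p = fst \<xi>) \<and>
     (\<forall>\<xi>\<in>B14_reg. \<forall>\<eta>\<in>B14. orbit14 b \<xi> = orbit14 b \<eta> \<longleftrightarrow>
        fst \<eta> = fst \<xi> \<and> (\<exists>k::int. snd \<eta> = snd \<xi> + 2 * pi * b * of_int k)) \<and>
     orbit_space_is X1 inv1 B14 \<and>
     (invariant_surface (X14 b) (orbit14 b) B14_reg (quot14 b) M I \<xi>1 \<xi>2 \<longrightarrow>
       (let \<psi> = (\<lambda>u v.
              (sqrt ((\<xi>1 u)\<^sup>2 - 4) * sin v / (sqrt ((\<xi>1 u)\<^sup>2 - 4) * cos v - \<xi>1 u),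
               2 / (\<xi>1 u - sqrt ((\<xi>1 u)\<^sup>2 - 4) * cos v),
               \<xi>2 u + b * v)) in
         surface_parametrization (X14 b) (orbit14 b) M I \<xi>1 \<xi>2 \<psi> \<and>
         ((\<forall>u\<in>I. deriv \<xi>2 u \<ge> 0) \<longrightarrow>
           loxodromes_given_by (X14 b) \<psi> I \<theta> (\<lambda>\<epsilon> u. \<psi> u
             (LBINT t=u0..u. (- 4 * b * sqrt ((\<xi>1 t)\<^sup>2 - 4 - (deriv \<xi>1 t)\<^sup>2) + \<epsilon> * (2 * ((\<xi>1 t)\<^sup>2 - 4) * cot \<theta>))
                / (((\<xi>1 t)\<^sup>2 - 4) * sqrt ((\<xi>1 t)\<^sup>2 + 4 * (b\<^sup>2 - 1)))))) \<and>
         loxodromes_given_by (X14 b) \<psi> I \<theta> (\<lambda>\<epsilon> u. \<psi> u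
             (LBINT t=u0..u. (- 4 * b * (sgn (deriv \<xi>2 t) * sqrt ((\<xi>1 t)\<^sup>2 - 4 - (deriv \<xi>1 t)\<^sup>2)) + \<epsilon> * (2 * ((\<xi>1 t)\<^sup>2 - 4) * cot \<theta>))
                / (((\<xi>1 t)\<^sup>2 - 4) * sqrt ((\<xi>1 t)\<^sup>2 + 4 * (b\<^sup>2 - 1))))))))"
proof (intro conjI)
  show "orbit_space_is (X24 b) (inv24 b) B24" by (rule orbit_space_X24)
  show "orbit_space_is (X34 b) (inv34 b) B34" by (rule orbit_space_X34)
  show "orbit_space_represented_by (X14 b) (orbit14 b) B14" by (rule orbit_space_represented_by_X14)
  show "\<forall>\<xi>\<in>B14. \<forall>p\<in>orbit14 b \<xi>. xi14 p = fst \<xi>" using xi14_orbit14 by blast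
  show "\<forall>\<xi>\<in>B14_reg. \<forall>\<eta>\<in>B14. orbit14 b \<xi> = orbit14 b \<eta> \<longleftrightarrow>
      fst \<eta> = fst \<xi> \<and> (\<exists>k::int. snd \<eta> = snd \<xi> + 2 * pi * b * of_int k)"
    using orbit14_cong_iff by blast
  show "orbit_space_is X1 inv1 B14" by (rule orbit_space_is_X1)
  show "invariant_surface (X24 b) (level (inv24 b)) B24 (quot24 b) M I \<xi>1 \<xi>2 \<longrightarrow>
       (let \<psi> = (\<lambda>u v. (v, \<xi>2 u, b * v - \<xi>1 u)) in
         surface_parametrization (X24 b) (level (inv24 b)) M I \<xi>1 \<xi>2 \<psi> \<and>
         ((\<forall>u\<in>I. deriv \<xi>1 u \<ge> 0) \<longrightarrow>
           loxodromes_given_by (X24 b) \<psi> I \<theta> (\<lambda>\<epsilon> u. \<psi> u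
             (LBINT t=u0..u. (b * sqrt ((\<xi>2 t)\<^sup>2 - (deriv \<xi>2 t)\<^sup>2) + \<epsilon> * cot \<theta>) * \<xi>2 t
                / sqrt (1 + b\<^sup>2 * (\<xi>2 t)\<^sup>2)))) \<and>
         loxodromes_given_by (X24 b) \<psi> I \<theta> (\<lambda>\<epsilon> u. \<psi> u
             (LBINT t=u0..u. (b * (sgn (deriv \<xi>1 t) * sqrt ((\<xi>2 t)\<^sup>2 - (deriv \<xi>2 t)\<^sup>2)) + \<epsilon> * cot \<theta>) * \<xi>2 t
                / sqrt (1 + b\<^sup>2 * (\<xi>2 t)\<^sup>2))))"
  proof (rule impI, unfold Let_def, goal_cases)
    case surf: 1
    note lox = invariant_immersion.loxodromes_given_by_integral[OF invariant_immersion_X24[OF surf] assms]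
    \<comment> \<open>Both versions of the integrand reduce to \<epsilon> cot \<theta> / sqrt G -
      F/G on I: the first uses the sign assumption on \<xi>1', the second the factor sgn.\<close>
    show ?case
      by (intro conjI impI surface_parametrization_X24[OF surf] lox)
        (simp_all only: integrand_X24[OF surf] sqrt_X24[OF surf])
  qed
  show "invariant_surface (X34 b) (level (inv34 b)) B34 (quot34 b) M I \<xi>1 \<xi>2 \<longrightarrow>
       (let \<psi> = (\<lambda>u v. (exp v * cos (\<xi>1 u), exp v * sin (\<xi>1 u), \<xi>2 u + b * v)) in
         surface_parametrization (X34 b) (level (inv34 b)) M I \<xi>1 \<xi>2 \<psi> \<and>
         ((\<forall>u\<in>I. deriv \<xi>2 u \<ge> 0) \<longrightarrow>
           loxodromes_given_by (X34 b) \<psi> I \<theta> (\<lambda>\<epsilon> u. \<psi> u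
             (LBINT t=u0..u. (- b * sqrt ((sin (\<xi>1 t))\<^sup>2 - (deriv \<xi>1 t)\<^sup>2) + \<epsilon> * cot \<theta>) * sin (\<xi>1 t)
                / sqrt (1 + b\<^sup>2 * (sin (\<xi>1 t))\<^sup>2)))) \<and>
         loxodromes_given_by (X34 b) \<psi> I \<theta> (\<lambda>\<epsilon> u. \<psi> u
             (LBINT t=u0..u. (- b * (sgn (deriv \<xi>2 t) * sqrt ((sin (\<xi>1 t))\<^sup>2 - (deriv \<xi>1 t)\<^sup>2)) + \<epsilon> * cot \<theta>) * sin (\<xi>1 t)
                / sqrt (1 + b\<^sup>2 * (sin (\<xi>1 t))\<^sup>2))))"
  proof (rule impI, unfold Let_def, goal_cases)
    case surf: 1
    note lox = invariant_immersion.loxodromes_given_by_integral[OF invariant_immersion_X34[OF surf] assms]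
    show ?case
      by (intro conjI impI surface_parametrization_X34[OF surf] lox)
        (simp_all only: integrand_X34[OF surf] sqrt_X34[OF surf])
  qed
  show "invariant_surface (X14 b) (orbit14 b) B14_reg (quot14 b) M I \<xi>1 \<xi>2 \<longrightarrow>
       (let \<psi> = (\<lambda>u v.
              (sqrt ((\<xi>1 u)\<^sup>2 - 4) * sin v / (sqrt ((\<xi>1 u)\<^sup>2 - 4) * cos v - \<xi>1 u),
               2 / (\<xi>1 u - sqrt ((\<xi>1 u)\<^sup>2 - 4) * cos v),
               \<xi>2 u + b * v)) in
         surface_parametrization (X14 b) (orbit14 b) M I \<xi>1 \<xi>2 \<psi> \<and>
         ((\<forall>u\<in>I. deriv \<xi>2 u \<ge> 0) \<longrightarrow>
           loxodromes_given_by (X14 b) \<psi> I \<theta> (\<lambda>\<epsilon> u. \<psi> u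
             (LBINT t=u0..u. (- 4 * b * sqrt ((\<xi>1 t)\<^sup>2 - 4 - (deriv \<xi>1 t)\<^sup>2) + \<epsilon> * (2 * ((\<xi>1 t)\<^sup>2 - 4) * cot \<theta>))
                / (((\<xi>1 t)\<^sup>2 - 4) * sqrt ((\<xi>1 t)\<^sup>2 + 4 * (b\<^sup>2 - 1)))))) \<and>
         loxodromes_given_by (X14 b) \<psi> I \<theta> (\<lambda>\<epsilon> u. \<psi> u
             (LBINT t=u0..u. (- 4 * b * (sgn (deriv \<xi>2 t) * sqrt ((\<xi>1 t)\<^sup>2 - 4 - (deriv \<xi>1 t)\<^sup>2)) + \<epsilon> * (2 * ((\<xi>1 t)\<^sup>2 - 4) * cot \<theta>))
                / (((\<xi>1 t)\<^sup>2 - 4) * sqrt ((\<xi>1 t)\<^sup>2 + 4 * (b\<^sup>2 - 1))))))"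
  proof (rule impI, unfold Let_def, goal_cases)
    case surf: 1
    \<comment> \<open>Unfolding the polar coordinates produces exactly the displayed
      parametrization.\<close>
    note lox = invariant_immersion.loxodromes_given_by_integral[OF invariant_immersion_X14[OF surf, unfolded polar14_def hyperboloid_pt_def] assms]
    show ?case
      by (intro conjI impI surface_parametrization_X14[OF surf, unfolded polar14_def hyperboloid_pt_def] lox)
        (simp_all only: integrand_X14[OF surf] sqrt_X14[OF surf])
  qed
  show "invariant_surface X2 (level (inv24 0)) B24 (quot24 0) M I \<xi>1 \<xi>2 \<longrightarrow>
       loxodromes_given_by X2 (\<lambda>u v. (v, \<xi>2 u, - \<xi>1 u)) I \<theta>
         (\<lambda>\<epsilon> u. (\<epsilon> * cot \<theta> * (LBINT t=u0..u. \<xi>2 t), \<xi>2 u, - \<xi>1 u))"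
    using loxodromes_X2[OF assms] by blast
  show "invariant_surface X4 (level inv4) B24 quot4 M I \<xi>1 \<xi>2 \<longrightarrow>
       (let \<psi> = (\<lambda>u v. (\<xi>1 u, \<xi>2 u, v)) in
         surface_parametrization X4 (level inv4) M I \<xi>1 \<xi>2 \<psi> \<and>
         M = {(x, y, z). (x, y) \<in> (\<lambda>u. (\<xi>1 u, \<xi>2 u)) ` I} \<and>
         (\<forall>J \<alpha>. loxodrome X4 \<psi> I \<theta> J \<alpha> \<longrightarrow> helix J \<alpha>) \<and>
         loxodromes_given_by X4 \<psi> I \<theta>
           (\<lambda>\<epsilon> u. (\<xi>1 u, \<xi>2 u, \<epsilon> * cot \<theta> * (u - u0))))"
    unfolding Let_def
  proof (intro impI conjI allI)
    assume surf: "invariant_surface X4 (level inv4) B24 quot4 M I \<xi>1 \<xi>2"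
    show par: "surface_parametrization X4 (level inv4) M I \<xi>1 \<xi>2 (\<lambda>u v. (\<xi>1 u, \<xi>2 u, v))"
      by (rule surface_parametrization_X4[OF surf])
    have M: "M = {(\<xi>1 u, \<xi>2 u, v) | u v. u \<in> I}"
      by (rule conjunct2[OF par[unfolded surface_parametrization_def]])
    show "M = {(x, y, z). (x, y) \<in> (\<lambda>u. (\<xi>1 u, \<xi>2 u)) ` I}"
      unfolding M by auto
    show "loxodromes_given_by X4 (\<lambda>u v. (\<xi>1 u, \<xi>2 u, v)) I \<theta>
        (\<lambda>\<epsilon> u. (\<xi>1 u, \<xi>2 u, \<epsilon> * cot \<theta> * (u - u0)))"
      by (rule loxodromes_X4[OF surf assms(1,2)])
    show "helix J \<alpha>" if "loxodrome X4 (\<lambda>u v. (\<xi>1 u, \<xi>2 u, v)) I \<theta> J \<alpha>" for J \<alpha>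
      by (rule helix_X4[OF surf assms(1,2) that])
  qed
qed

end
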